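(* Let $k\ge 2$, let $G=(V,E)$ be the graph of a simplicial $k$-circuit $\mathcal S$, let $X\subseteq V$, let $*:X\to X$ be a non-adjacent vertex pairing of $G$, and let $\Gamma$ be a point group of $\mathbb R^{k+1}$ of order two. Suppose that $|X|\le 2k$. Then $(G,* )$ is $\Gamma$-rigid in $\mathbb R^{k+1}$.
   Context: A simplicial $k$-multicomplex $\mathcal S$ is a finite multiset whose elements ($k$-faces) are $(k+1)$-sets; a $j$-face is a $(j+1)$-set contained in some element of $\mathcal S$. $V(\mathcal S)$ is the set of vertices ($0$-faces), $E(\mathcal S)$ the set of $1$-faces, and the graph of $\mathcal S$ is the simple graph $G(\mathcal S)$ with vertex set $V(\mathcal S)$ and edge set $E(\mathcal S)$. The boundary $\partial\mathcal S$ is the set of $k$-subsets of $V(\mathcal S)$ contained in an odd number of elements of $\mathcal S$ (counted with multiplicity). $\mathcal S$ is a simplicial $k$-cycle if $\partial\mathcal S=\emptyset$; it is a simplicial $k$-circuit if it is a non-empty simplicial $k$-cycle and no proper non-empty sub-multiset is a simplicial $k$-cycle. A non-adjacent vertex pairing of a graph $G=(V,E)$ is a map $*:X\to X$, $u\mapsto u^*$, on some subset $X\subseteq V$ with $(u^* )^*=u$, $u^*\ne u$ and $uu^*\notin E$ for all $u\in X$ (it need not be induced by a graph automorphism). A framework $(G,p)$ in $\mathbb R^d$ is a finite simple graph $G$ with a map $p:V(G)\to\mathbb R^d$. An infinitesimal motion is a map $\dot p:V(G)\to\mathbb R^d$ with $(p(i)-p(j))\cdot(\dot p(i)-\dot p(j))=0$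 for all edges $ij$; it is trivial if $\dot p(i)=Sp(i)+t_0$ for all $i$, for some skew-symmetric matrix $S$ and $t_0\in\mathbb R^d$. $(G,p)$ is infinitesimally rigid if all its infinitesimal motions are trivial. A point group of $\mathbb R^d$ of order two is a subgroup $\Gamma$ of $O(d)$ of order two; let $\gamma$ be its non-identity element. $(G,* )$ is $\Gamma$-rigid in $\mathbb R^d$ if there is $p:V(G)\to\mathbb R^d$ with $p(u^* )=\gamma(p(u))$ for all $u\in X$ such that $(G,p)$ is infinitesimally rigid. *)

theory Defs
  imports
    "HOL-Analysis.Analysis"
    "HOL-Algebra.Group"
    "HOL-Library.Multiset"
begin

definition multicomplex :: "nat \<Rightarrow> 'v set multiset \<Rightarrow> bool" where
  "multicomplex k S \<longleftrightarrow> (\<forall>s \<in># S. finite s \<and> card s = k + 1)"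

definition faces :: "nat \<Rightarrow> 'v set multiset \<Rightarrow> 'v set set" where
  "faces j S = {F. finite F \<and> card F = j + 1 \<and> (\<exists>s \<in># S. F \<subseteq> s)}"

text \<open>The \<open>0\<close>-faces are singletons; a vertex \<open>v\<close> is identified with the face \<open>{v}\<close>.\<close>

definition vertices :: "'v set multiset \<Rightarrow> 'v set" where
  "vertices S = {v. {v} \<in> faces 0 S}"

definition boundary :: "nat \<Rightarrow> 'v set multiset \<Rightarrow> 'v set set" where
  "boundary k S =
     {F. F \<subseteq> vertices S \<and> finite F \<and> card F = k \<and> odd (size {#s \<in># S. F \<subseteq> s#})}"

definition simplicial_cycle :: "nat \<Rightarrow> 'v set multiset \<Rightarrow> bool" where
  "simplicial_cycle k S \<longleftrightarrow> multicomplex k S \<and> boundary k S = {}"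

definition simplicial_circuit :: "nat \<Rightarrow> 'v set multiset \<Rightarrow> bool" where
  "simplicial_circuit k S \<longleftrightarrow>
     simplicial_cycle k S \<and> S \<noteq> {#} \<and>
     (\<forall>T. T \<subset># S \<and> T \<noteq> {#} \<longrightarrow> \<not> simplicial_cycle k T)"

text \<open>A graph is a pair of a vertex set and a set of unordered edges.\<close>

type_synonym 'v graph = "'v set \<times> 'v set set"

definition finite_simple_graph :: "'v graph \<Rightarrow> bool" where
  "finite_simple_graph G \<longleftrightarrow>
     finite (fst G) \<and> (\<forall>e \<in> snd G. e \<subseteq> fst G \<and> card e = 2)"

definition graph_of :: "'v set multiset \<Rightarrow> 'v graph" where
  "graph_of S = (vertices S, faces 1 S)"

lemma finite_simple_graph_graph_of:
  assumes "multicomplex k S"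
  shows "finite_simple_graph (graph_of S)"
proof -
  have V: "vertices S = \<Union> (set_mset S)"
    by (auto simp: vertices_def faces_def)
  have "finite (vertices S)"
    using assms unfolding V multicomplex_def by auto
  then show ?thesis
    unfolding finite_simple_graph_def graph_of_def using V
    by (auto simp: faces_def)
qed

text \<open>The pairing \<open>star\<close> is a total function of which only the values on \<open>X\<close> matter.\<close>

definition nonadjacent_pairing :: "'v graph \<Rightarrow> 'v set \<Rightarrow> ('v \<Rightarrow> 'v) \<Rightarrow> bool" where
  "nonadjacent_pairing G X star \<longleftrightarrow>
     X \<subseteq> fst G \<and>
     (\<forall>u \<in> X. star u \<in> X \<and> star (star u) = u \<and> star u \<noteq> u \<and> {u, star u} \<notin> snd G)"

text \<open>
  Placements and motions are total functions of which only the values on the vertex set of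
  \<open>G\<close> matter.
\<close>

definition infinitesimal_motion ::
    "'v graph \<Rightarrow> ('v \<Rightarrow> real^'n) \<Rightarrow> ('v \<Rightarrow> real^'n) \<Rightarrow> bool" where
  "infinitesimal_motion G p m \<longleftrightarrow>
     (\<forall>i j. {i, j} \<in> snd G \<longrightarrow> (p i - p j) \<bullet> (m i - m j) = 0)"

definition trivial_motion ::
    "'v graph \<Rightarrow> ('v \<Rightarrow> real^'n) \<Rightarrow> ('v \<Rightarrow> real^'n) \<Rightarrow> bool" where
  "trivial_motion G p m \<longleftrightarrow>
     (\<exists>(A :: real^'n^'n) t. transpose A = - A \<and> (\<forall>i \<in> fst G. m i = A *v p i + t))"

definition infinitesimally_rigid :: "'v graph \<Rightarrow> ('v \<Rightarrow> real^'n) \<Rightarrow> bool" where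
  "infinitesimally_rigid G p \<longleftrightarrow>
     (\<forall>m. infinitesimal_motion G p m \<longrightarrow> trivial_motion G p m)"

definition orthogonal_group :: "(real^'n^'n) monoid" where
  "orthogonal_group = \<lparr>carrier = {A. orthogonal_matrix A}, mult = (**), one = mat 1\<rparr>"

lemma group_orthogonal_group: "group (orthogonal_group :: (real^'n^'n) monoid)"
proof (rule groupI)
  fix A :: "real^'n^'n"
  assume "A \<in> carrier orthogonal_group"
  then show "\<exists>B \<in> carrier orthogonal_group. B \<otimes>\<^bsub>orthogonal_group\<^esub> A = \<one>\<^bsub>orthogonal_group\<^esub>"
    by (intro bexI[of _ "transpose A"])
       (auto simp: orthogonal_group_def orthogonal_matrix_def)
qed (auto simp: orthogonal_group_def orthogonal_matrix_mul orthogonal_matrix_id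
      matrix_mul_assoc)

definition point_group_of_order_two :: "(real^'n^'n) set \<Rightarrow> bool" where
  "point_group_of_order_two \<Gamma> \<longleftrightarrow> subgroup \<Gamma> orthogonal_group \<and> card \<Gamma> = 2"

definition nonidentity :: "(real^'n^'n) set \<Rightarrow> real^'n^'n" where
  "nonidentity \<Gamma> = (THE g. g \<in> \<Gamma> \<and> g \<noteq> mat 1)"

lemma ex1_nonidentity:
  assumes "point_group_of_order_two \<Gamma>"
  shows "\<exists>!g. g \<in> \<Gamma> \<and> g \<noteq> mat 1"
proof -
  have "mat 1 \<in> \<Gamma>"
    using assms subgroup.one_closed
    by (fastforce simp: point_group_of_order_two_def orthogonal_group_def)
  moreover obtain a b where "\<Gamma> = {a, b}" "a \<noteq> b"
    using assms by (auto simp: point_group_of_order_two_def card_2_iff)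
  ultimately show ?thesis by auto
qed

definition Gamma_rigid ::
    "(real^'n^'n) set \<Rightarrow> 'v graph \<Rightarrow> 'v set \<Rightarrow> ('v \<Rightarrow> 'v) \<Rightarrow> bool" where
  "Gamma_rigid \<Gamma> G X star \<longleftrightarrow>
     (\<exists>p :: 'v \<Rightarrow> real^'n.
        (\<forall>u \<in> X. p (star u) = nonidentity \<Gamma> *v p u) \<and> infinitesimally_rigid G p)"

end

theory Submission
  imports Defs
begin

text \<open>
  The proof is an induction along edge contractions, in the style of Fogelsanger's proof that the
  graph of a simplicial \<open>k\<close>-circuit is rigid in dimension \<open>d = k + 1\<close>.  A circuit is a
  repeated simplex or a set \<open>C\<close> of \<open>(k + 1)\<close>-sets; in the second case an edge \<open>uv\<close>
  is chosen and \<open>v\<close> is contracted to \<open>u\<close>.  The faces of \<open>C\<close> that do not contain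
  both \<open>u\<close> and \<open>v\<close> split into sets \<open>B\<close> whose contractions are circuits or
  single simplices.  Each \<open>B\<close> is completed to a cycle by faces through \<open>uv\<close> (its
  \<^emph>\<open>cap\<close>), which need not belong to \<open>C\<close> but whose edges do.  By induction the contraction
  of \<open>B\<close> has a rigid placement; vertex splitting makes \<open>B\<close>, with the edge \<open>uv\<close>,
  rigid (\<open>split_rigid\<close>); and the rigid pieces are glued along faces of caps
  (\<open>glue\<close>), where minimality of \<open>C\<close> shows that everything is connected.

  Three points make this work in the presence of the pairing.

  Firstly, \<open>v\<close> is always chosen outside \<open>X\<close>.  Then the position of \<open>v\<close> is
  unconstrained, so vertex splitting never leaves the space of symmetric placements.

  Secondly, contracting \<open>v\<close> to \<open>u\<close> may make \<open>u\<close> adjacent to its partner.  The statement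
  proved by induction (\<open>circuit_rigid\<close>) therefore allows one pair to be adjacent.  The
  bound \<open>card X \<le> 2 * k\<close> guarantees that a contraction preserving this weaker condition
  exists (\<open>contractible_edge\<close>).  One pair is harmless: for a non-trivial involution \<open>g\<close>
  there are points \<open>z\<close> with \<open>g z \<noteq> z\<close>, so \<open>d\<close> vertices containing at most one
  pair can be placed affinely independently (\<open>affind_feasible\<close>).

  Thirdly, finitely many conditions on a symmetric placement have to hold at once.  All of them
  say that a linear map depending affinely on the placement is injective, so each of them, once it
  holds at a point of a line of placements, fails at only finitely many points of that line
  (\<open>pencil_finite\<close>).  Hence conditions that can be met one at a time can be met together
  (\<open>generic_conj\<close>).  The same fact turns the degenerate framework with \<open>u\<close> and \<open>v\<close>
  at the same point into a rigid one (\<open>vertex_split\<close>).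
\<close>

section \<open>Affine pencils of linear maps\<close>

text \<open>
  A homogeneous linear system with fewer equations than unknowns has a non-trivial solution.  The
  unknowns are indexed by an arbitrary finite set rather than by a finite type.
\<close>

lemma underdetermined_system:
  fixes w :: "'t \<Rightarrow> 'e \<Rightarrow> real"
  assumes "finite E" "finite T" "card E < card T"
  shows "\<exists>c. (\<exists>t\<in>T. c t \<noteq> 0) \<and> (\<forall>e\<in>E. (\<Sum>t\<in>T. c t * w t e) = 0)"
  using assms
proof (induction E arbitrary: T w rule: finite_induct)
  case empty
  then obtain t where "t \<in> T" by (metis card_gt_0_iff ex_in_conv gr_zeroI not_less0)
  then show ?case by (intro exI[of _ "\<lambda>_. 1"]) auto
next
  case (insert e E)
  show ?case
  proof (cases "\<forall>t\<in>T. w t e = 0")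
    case True
    have "card E < card T" using insert by simp
    from insert.IH[OF insert.prems(1) this, of w] obtain c where
      "\<exists>t\<in>T. c t \<noteq> 0" "\<forall>e\<in>E. (\<Sum>t\<in>T. c t * w t e) = 0" by blast
    moreover have "(\<Sum>t\<in>T. c t * w t e) = 0" using True by simp
    ultimately show ?thesis by blast
  next
    case False
    then obtain s where s: "s \<in> T" "w s e \<noteq> 0" by blast
    define r where "r t = w t e / w s e" for t
    have "card E < card (T - {s})" using insert s by simp
    from insert.IH[OF _ this, of "\<lambda>t e'. w t e' - r t * w s e'"] insert.prems(1)
    obtain c where c: "\<exists>t\<in>T - {s}. c t \<noteq> 0"
      "\<forall>e'\<in>E. (\<Sum>t\<in>T - {s}. c t * (w t e' - r t * w s e')) = 0" by blast
    define c' where "c' = c(s := - (\<Sum>t\<in>T - {s}. c t * r t))"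
    have eq: "(\<Sum>t\<in>T. c' t * w t e') = (\<Sum>t\<in>T - {s}. c t * (w t e' - r t * w s e'))" for e'
    proof -
      have "(\<Sum>t\<in>T. c' t * w t e') = c' s * w s e' + (\<Sum>t\<in>T - {s}. c' t * w t e')"
        using s insert.prems(1) by (simp add: sum.remove)
      also have "(\<Sum>t\<in>T - {s}. c' t * w t e') = (\<Sum>t\<in>T - {s}. c t * w t e')"
        by (rule sum.cong) (auto simp: c'_def)
      also have "c' s * w s e' = - (\<Sum>t\<in>T - {s}. c t * (r t * w s e'))"
        by (simp add: c'_def sum_distrib_right mult.assoc)
      finally show ?thesis by (simp add: right_diff_distrib sum_subtractf)
    qed
    have "(\<Sum>t\<in>T. c' t * w t e') = 0" if "e' \<in> insert e E" for e'
      using that unfolding eq using c(2) s by (auto simp: r_def)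
    moreover have "\<exists>t\<in>T. c' t \<noteq> 0" using c(1) by (auto simp: c'_def)
    ultimately show ?thesis by blast
  qed
qed

text \<open>
  Linearity of a map on a function space, stated pointwise because functions between arbitrary
  types do not form an instance of the class of real vector spaces.
\<close>

definition fun_linear :: "(('v \<Rightarrow> 'b::real_vector) \<Rightarrow> 'w::real_vector) \<Rightarrow> bool" where
  "fun_linear h \<longleftrightarrow> (\<forall>f g. h (\<lambda>x. f x + g x) = h f + h g) \<and>
     (\<forall>c f. h (\<lambda>x. c *\<^sub>R f x) = c *\<^sub>R h f)"

lemma fun_linear_sum:
  assumes "fun_linear h" "finite T"
  shows "h (\<lambda>x. \<Sum>t\<in>T. c t *\<^sub>R m t x) = (\<Sum>t\<in>T. c t *\<^sub>R h (m t))"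
  using assms(2)
proof (induction T rule: finite_induct)
  case empty
  have "h (\<lambda>x. 0 *\<^sub>R undefined x) = 0 *\<^sub>R h undefined"
    using assms(1) unfolding fun_linear_def by blast
  then show ?case by simp
next
  case (insert t T)
  then show ?case using assms(1) unfolding fun_linear_def by (simp add: insert)
qed

text \<open>
  Let \<open>a i + t * b i\<close> be a pencil of linear maps on the functions supported in a finite set.
  If the joint kernel is trivial at \<open>t = 0\<close>, then it is trivial for all but finitely many
  \<open>t\<close>: kernel elements for distinct \<open>t\<close> are linearly independent, by the argument used for
  eigenvectors.
\<close>

lemma pencil_finite:
  fixes a b :: "'i \<Rightarrow> ('v \<Rightarrow> 'b::euclidean_space) \<Rightarrow> 'w::real_vector"
  assumes "finite V"
    and a: "\<And>i. fun_linear (a i)" and b: "\<And>i. fun_linear (b i)"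
    and inj: "\<And>m. (\<And>x. x \<notin> V \<Longrightarrow> m x = 0) \<Longrightarrow> (\<And>i. a i m = 0) \<Longrightarrow> m = (\<lambda>_. 0)"
  shows "finite {t. \<exists>m. (\<forall>x. x \<notin> V \<longrightarrow> m x = 0) \<and> m \<noteq> (\<lambda>_. 0) \<and>
            (\<forall>i. a i m + t *\<^sub>R b i m = 0)}" (is "finite ?bad")
proof -
  define bad where "bad = ?bad"
  obtain M where M: "\<And>t x. t \<in> bad \<Longrightarrow> x \<notin> V \<Longrightarrow> M t x = 0"
    "\<And>t. t \<in> bad \<Longrightarrow> M t \<noteq> (\<lambda>_. 0)"
    "\<And>t i. t \<in> bad \<Longrightarrow> a i (M t) + t *\<^sub>R b i (M t) = 0"
  proof -
    have "\<forall>t\<in>bad. \<exists>m. (\<forall>x. x \<notin> V \<longrightarrow> m x = 0) \<and> m \<noteq> (\<lambda>_. 0) \<and>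
            (\<forall>i. a i m + t *\<^sub>R b i m = 0)" unfolding bad_def by simp
    then obtain M where "\<forall>t\<in>bad. (\<forall>x. x \<notin> V \<longrightarrow> M t x = 0) \<and> M t \<noteq> (\<lambda>_. 0) \<and>
            (\<forall>i. a i (M t) + t *\<^sub>R b i (M t) = 0)" unfolding bchoice_iff by (rule exE)
    then show ?thesis by (intro that[of M]) simp_all
  qed
  have nz: "t \<noteq> 0" if "t \<in> bad" for t
  proof
    assume "t = 0"
    with M(3)[OF that] have "a i (M t) = 0" for i by (metis add.right_neutral scaleR_zero_left)
    with inj[of "M t"] M(1,2)[OF that] show False by metis
  qed
  have indep: "\<forall>t\<in>T. c t = 0"
    if "finite T" "T \<subseteq> bad" "\<forall>x. (\<Sum>t\<in>T. c t *\<^sub>R M t x) = 0" for T c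
    using that
  proof (induction T arbitrary: c rule: finite_induct)
    case (insert s T)
    define S where "S = insert s T"
    have S: "finite S" "S \<subseteq> bad" using insert by (auto simp: S_def)
    have z: "(\<lambda>x. \<Sum>t\<in>S. c t *\<^sub>R M t x) = (\<lambda>_. 0)" using insert.prems(2) unfolding S_def by (intro ext) (rule spec)
    have b0: "b i (\<lambda>_. 0) = 0" for i
      using fun_linear_sum[OF b, of "{}" i] by simp
    \<comment> \<open>Dividing the coefficients by \<open>t\<close> gives a second relation; a combination of the two eliminates \<open>s\<close>.\<close>
    define m where "m = (\<lambda>x. \<Sum>t\<in>S. (c t / t) *\<^sub>R M t x)"
    have am: "a i m = 0" for i
    proof -
      have "a i m = (\<Sum>t\<in>S. (c t / t) *\<^sub>R a i (M t))"
        unfolding m_def by (rule fun_linear_sum[OF a S(1)])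
      also have "\<dots> = (\<Sum>t\<in>S. - (c t *\<^sub>R b i (M t)))"
      proof (rule sum.cong)
        fix t assume "t \<in> S"
        then have t: "t \<in> bad" using S by blast
        have "a i (M t) = - (t *\<^sub>R b i (M t))" using M(3)[OF t, of i] by (simp add: eq_neg_iff_add_eq_0)
        then show "(c t / t) *\<^sub>R a i (M t) = - (c t *\<^sub>R b i (M t))" using nz[OF t] by simp
      qed simp
      also have "\<dots> = - b i (\<lambda>x. \<Sum>t\<in>S. c t *\<^sub>R M t x)"
        by (simp add: fun_linear_sum[OF b S(1)] sum_negf)
      finally show ?thesis using z b0 by simp
    qed
    have mV: "m x = 0" if "x \<notin> V" for x
    proof -
      have "M t x = 0" if "t \<in> S" for t using M(1) S(2) \<open>x \<notin> V\<close> that by blast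
      then show ?thesis by (simp add: m_def)
    qed
    have m0: "m = (\<lambda>_. 0)" by (rule inj[of m, OF mV am])
    have "(\<Sum>t\<in>T. (c t - s * (c t / t)) *\<^sub>R M t x) = 0" for x
    proof -
      have "(\<Sum>t\<in>S. (c t - s * (c t / t)) *\<^sub>R M t x)
          = (\<Sum>t\<in>S. c t *\<^sub>R M t x) - s *\<^sub>R m x"
        unfolding m_def scaleR_left_diff_distrib sum_subtractf scaleR_sum_right scaleR_scaleR ..
      also have "\<dots> = 0" using fun_cong[OF z, of x] fun_cong[OF m0, of x] by simp
      finally show ?thesis using insert.hyps nz[of s] insert.prems by (simp add: S_def)
    qed
    then have "\<forall>x. (\<Sum>t\<in>T. (c t - s * (c t / t)) *\<^sub>R M t x) = 0" by (rule allI)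
    with insert.prems(1) have *: "\<forall>t\<in>T. c t - s * (c t / t) = 0"
      by (intro insert.IH) simp_all
    have T0: "c t = 0" if "t \<in> T" for t
    proof -
      have "t \<noteq> 0" using nz that insert.prems by blast
      moreover have "t \<noteq> s" using that insert.hyps by blast
      moreover have "c t - s * (c t / t) = 0" using * that by blast
      then have "c t * (1 - s / t) = 0" by (simp add: right_diff_distrib mult.commute)
      ultimately show ?thesis by simp
    qed
    have "(\<Sum>t\<in>S. c t *\<^sub>R M t x) = c s *\<^sub>R M s x" for x
      unfolding S_def using insert.hyps T0 by simp
    moreover have "M s \<noteq> (\<lambda>_. 0)" using M(2) insert.prems(1) by simp
    then obtain x where "M s x \<noteq> 0" unfolding fun_eq_iff by blast
    ultimately have "c s = 0" using fun_cong[OF z, of x] by (metis scaleR_eq_0_iff)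
    then show ?case using T0 by simp
  qed simp
  define N where "N = card (V \<times> (Basis :: 'b set))"
  have "card T \<le> N" if "finite T" "T \<subseteq> bad" for T
  proof (rule ccontr)
    assume "\<not> card T \<le> N"
    then have "card (V \<times> (Basis :: 'b set)) < card T" by (simp add: N_def)
    from underdetermined_system[OF _ that(1) this, of "\<lambda>t z. M t (fst z) \<bullet> snd z"] assms(1)
    have "\<exists>c. (\<exists>t\<in>T. c t \<noteq> 0) \<and>
      (\<forall>z\<in>V \<times> (Basis :: 'b set). (\<Sum>t\<in>T. c t * (M t (fst z) \<bullet> snd z)) = 0)"
      by simp
    then obtain c where c: "\<exists>t\<in>T. c t \<noteq> 0"
      "\<forall>z\<in>V \<times> (Basis :: 'b set). (\<Sum>t\<in>T. c t * (M t (fst z) \<bullet> snd z)) = 0"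
      by (elim exE conjE)
    have "(\<Sum>t\<in>T. c t *\<^sub>R M t x) = 0" for x
    proof (cases "x \<in> V")
      case True
      show ?thesis
        by (rule euclidean_eqI) (use c(2) True in \<open>simp add: inner_sum_left\<close>)
    next
      case False
      have "M t x = 0" if "t \<in> T" for t using M(1) \<open>T \<subseteq> bad\<close> False that by blast
      then show ?thesis by simp
    qed
    with indep[OF that, of c] c(1) show False by blast
  qed
  then have "finite bad"
    by (metis Suc_n_not_le_n infinite_arbitrarily_large)
  then show ?thesis unfolding bad_def .
qed

section \<open>Affinely independent points and trivial motions\<close>

text \<open>
  Affine independence of the indexed family of points \<open>p i\<close> for \<open>i\<close> in a finite set \<open>K\<close>; in
  particular \<open>p\<close> is injective on \<open>K\<close>.
\<close>

definition affind :: "'v set \<Rightarrow> ('v \<Rightarrow> real^'n) \<Rightarrow> bool" where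
  "affind K p \<longleftrightarrow> (\<forall>c. (\<Sum>i\<in>K. c i *\<^sub>R p i) = 0 \<and> (\<Sum>i\<in>K. c i) = 0 \<longrightarrow> (\<forall>i\<in>K. c i = 0))"

lemma affind_cong: "(\<And>i. i \<in> K \<Longrightarrow> p i = q i) \<Longrightarrow> affind K p = affind K q"
  unfolding affind_def by simp

lemma affind_independent_differences:
  fixes p :: "'v \<Rightarrow> real^'n"
  assumes "affind K p" "finite K" "i0 \<in> K"
  shows "inj_on (\<lambda>i. p i - p i0) (K - {i0})" (is "inj_on ?q _")
    and "independent ((\<lambda>i. p i - p i0) ` (K - {i0}))"
proof -
  have key: "\<forall>i\<in>K - {i0}. c i = 0" if "(\<Sum>i\<in>K - {i0}. c i *\<^sub>R ?q i) = 0" for c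
  proof -
    define c' where "c' = c(i0 := - (\<Sum>i\<in>K - {i0}. c i))"
    have S1: "(\<Sum>i\<in>K. c' i) = 0"
      using assms by (simp add: c'_def sum.remove)
    have "(\<Sum>i\<in>K. c' i *\<^sub>R p i) = (\<Sum>i\<in>K. c' i *\<^sub>R p i) - (\<Sum>i\<in>K. c' i) *\<^sub>R p i0"
      using S1 by simp
    also have "\<dots> = (\<Sum>i\<in>K. c' i *\<^sub>R ?q i)"
      by (simp add: scaleR_right_diff_distrib sum_subtractf scaleR_left.sum)
    also have "\<dots> = (\<Sum>i\<in>K - {i0}. c' i *\<^sub>R ?q i)"
      using assms by (simp add: sum.remove)
    also have "\<dots> = 0" using that by (simp add: c'_def)
    finally have "\<forall>i\<in>K. c' i = 0" using assms(1) S1 unfolding affind_def by blast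
    then show ?thesis by (metis DiffD1 DiffD2 c'_def fun_upd_other singletonI)
  qed
  have fin: "finite (K - {i0})" using assms by simp
  show inj: "inj_on ?q (K - {i0})"
  proof (rule inj_onI, rule ccontr)
    fix i j assume ij: "i \<in> K - {i0}" "j \<in> K - {i0}" "?q i = ?q j" "i \<noteq> j"
    define c where "c l = (if l = i then 1 else if l = j then -1 else 0 :: real)" for l
    have "(\<Sum>l\<in>K - {i0}. c l *\<^sub>R ?q l) = (\<Sum>l\<in>{i, j}. c l *\<^sub>R ?q l)"
      by (rule sum.mono_neutral_right) (use fin ij in \<open>auto simp: c_def\<close>)
    also have "\<dots> = 0" using ij by (simp add: c_def)
    finally have "c i = 0" using key ij by blast
    then show False by (simp add: c_def)
  qed
  show "independent (?q ` (K - {i0}))"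
  proof
    assume "dependent (?q ` (K - {i0}))"
    then obtain u where u: "\<exists>v\<in>?q ` (K - {i0}). u v \<noteq> 0"
      "(\<Sum>v\<in>?q ` (K - {i0}). u v *\<^sub>R v) = 0"
      using fin by (subst (asm) dependent_finite) blast+
    have "(\<Sum>i\<in>K - {i0}. u (?q i) *\<^sub>R ?q i) = 0"
      using u(2) by (simp add: sum.reindex[OF inj] o_def)
    from key[OF this] u(1) show False by blast
  qed
qed

text \<open>
  An affinely independent family of as many points as the dimension spans a hyperplane; together
  with a normal vector, the differences form a basis.
\<close>

lemma affind_normal:
  fixes p :: "'v \<Rightarrow> real^'n"
  assumes "affind K p" "finite K" "i0 \<in> K" "card K = CARD('n)"
  obtains \<nu> where "\<nu> \<noteq> 0" "\<And>i. i \<in> K \<Longrightarrow> \<nu> \<bullet> (p i - p i0) = 0"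
    "\<nu> \<notin> (\<lambda>i. p i - p i0) ` (K - {i0})"
    "independent (insert \<nu> ((\<lambda>i. p i - p i0) ` (K - {i0})))"
    "span (insert \<nu> ((\<lambda>i. p i - p i0) ` (K - {i0}))) = UNIV"
proof -
  define Q where "Q = (\<lambda>i. p i - p i0) ` (K - {i0})"
  have ind: "independent Q" and cQ: "card Q = CARD('n) - 1"
    using affind_independent_differences[OF assms(1-3)] assms
    by (auto simp: Q_def card_image)
  have finQ: "finite Q" using assms by (simp add: Q_def)
  have "dim Q < DIM(real^'n)"
    using ind cQ by (simp add: dim_eq_card_independent)
  then obtain \<nu> where \<nu>: "\<nu> \<noteq> 0" "span Q \<subseteq> {x. \<nu> \<bullet> x = 0}"
    using lowdim_subset_hyperplane[of Q] by blast
  have nin: "\<nu> \<notin> span Q" using \<nu> by auto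
  then have ind': "independent (insert \<nu> Q)" using ind by (simp add: independent_insert)
  have "\<nu> \<notin> Q" using nin span_base by blast
  then have "card (insert \<nu> Q) = CARD('n)" using finQ cQ by simp
  then have "dim (insert \<nu> Q) = DIM(real^'n)"
    using ind' by (simp add: dim_eq_card_independent)
  then have "span (insert \<nu> Q) = UNIV" using dim_eq_full[of "insert \<nu> Q"] by simp
  moreover have "\<nu> \<bullet> (p i - p i0) = 0" if "i \<in> K" for i
  proof (cases "i = i0")
    case False
    then have "p i - p i0 \<in> span Q" using that by (auto simp: Q_def intro!: span_base)
    then show ?thesis using \<nu> by blast
  qed simp
  ultimately show ?thesis using that \<nu>(1) ind' \<open>\<nu> \<notin> Q\<close> by (simp add: Q_def)
qed

lemma skew_inner:
  fixes A :: "real^'n^'n"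
  assumes "transpose A = - A"
  shows "x \<bullet> (A *v y) = - ((A *v x) \<bullet> y)"
proof -
  have "x \<bullet> (A *v y) = (transpose A *v x) \<bullet> y"
    by (simp add: dot_lmul_matrix)
  also have "transpose A *v x = - (A *v x)"
    using assms by (simp add: matrix_vector_mult_def vec_eq_iff sum_negf)
  finally show ?thesis by simp
qed

lemma span_inner_eq_0:
  assumes "\<And>y. y \<in> S \<Longrightarrow> (n :: 'a::euclidean_space) \<bullet> y = 0" "span S = UNIV"
  shows "n = 0"
proof -
  have "n \<in> span S" using assms by simp
  then have "n \<bullet> n = 0"
    using orthogonal_to_span[of n S n] assms(1) by (simp add: orthogonal_def)
  then show ?thesis by simp
qed

lemma trivial_motion_vanishing:
  fixes p :: "'v \<Rightarrow> real^'n"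
  assumes "affind K p" "finite K" "card K = CARD('n)" "transpose A = - A"
    and van: "\<And>i. i \<in> K \<Longrightarrow> A *v p i + t = 0"
  shows "A *v x = 0" "t = 0"
proof -
  have "K \<noteq> {}" using assms by auto
  then obtain i0 where i0: "i0 \<in> K" by blast
  obtain \<nu> where \<nu>: "span (insert \<nu> ((\<lambda>i. p i - p i0) ` (K - {i0}))) = UNIV"
    using affind_normal[OF assms(1,2) i0 assms(3)] by metis
  have q0: "A *v (p i - p i0) = 0" if "i \<in> K" for i
    using van[OF that] van[OF i0] by (simp add: matrix_vector_mult_diff_distrib) (metis add_right_cancel)
  have "A *v \<nu> = 0"
  proof (rule span_inner_eq_0[OF _ \<nu>])
    fix y assume "y \<in> insert \<nu> ((\<lambda>i. p i - p i0) ` (K - {i0}))"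
    then consider "y = \<nu>" | i where "i \<in> K" "y = p i - p i0" by blast
    then show "(A *v \<nu>) \<bullet> y = 0"
    proof cases
      case 1
      then show ?thesis using skew_inner[OF assms(4), of \<nu> \<nu>] by (simp add: inner_commute)
    next
      case 2
      then show ?thesis using skew_inner[OF assms(4), of \<nu> y] q0 by simp
    qed
  qed
  have "x \<in> span (insert \<nu> ((\<lambda>i. p i - p i0) ` (K - {i0})))" for x using \<nu> by simp
  from this have A0: "A *v x = 0" for x
  proof (induction x rule: span_induct)
    show "subspace {x. A *v x = 0}"
      by (auto simp: subspace_def matrix_vector_right_distrib matrix_vector_mult_scaleR)
  qed (use q0 \<open>A *v \<nu> = 0\<close> in auto)
  show "A *v x = 0" by (rule A0)
  show "t = 0" using van[OF i0] A0 by simp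
qed

text \<open>
  On a complete graph with affinely independent vertices, as many as the dimension, every
  infinitesimal motion is trivial.  A linear map \<open>B\<close> with the prescribed values on the
  hyperplane of differences and with \<open>B n = 0\<close> for the unit normal \<open>n\<close> is corrected in the
  normal direction, so that the result is skew.
\<close>

lemma skew_extension:
  fixes p m :: "'v \<Rightarrow> real^'n"
  assumes "affind K p" "finite K" "card K = CARD('n)"
    and mot: "\<And>i j. i \<in> K \<Longrightarrow> j \<in> K \<Longrightarrow> (p i - p j) \<bullet> (m i - m j) = 0"
  shows "\<exists>(A :: real^'n^'n) t. transpose A = - A \<and> (\<forall>i\<in>K. m i = A *v p i + t)"
proof -
  have "K \<noteq> {}" using assms by auto
  then obtain i0 where i0: "i0 \<in> K" by blast
  define q where "q i = p i - p i0" for i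
  define Q where "Q = q ` (K - {i0})"
  obtain \<nu> where \<nu>: "\<nu> \<noteq> 0" "\<And>i. i \<in> K \<Longrightarrow> \<nu> \<bullet> q i = 0" "\<nu> \<notin> Q"
    "independent (insert \<nu> Q)" "span (insert \<nu> Q) = UNIV"
    using affind_normal[OF assms(1,2) i0 assms(3)] unfolding q_def Q_def by metis
  have inj: "inj_on q (K - {i0})"
    using affind_independent_differences(1)[OF assms(1,2) i0] unfolding q_def .
  define f where "f x = (if x = \<nu> then 0 else m (the_inv_into (K - {i0}) q x) - m i0)" for x
  obtain B where B: "linear B" "\<And>x. x \<in> insert \<nu> Q \<Longrightarrow> B x = f x"
    using linear_independent_extend[OF \<nu>(4), of f] by blast
  have Bq: "B (q i) = m i - m i0" if "i \<in> K" for i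
  proof (cases "i = i0")
    case True
    then show ?thesis using B(1) by (simp add: q_def linear_0)
  next
    case False
    then have "q i \<in> Q" using that by (simp add: Q_def)
    moreover from this have "q i \<noteq> \<nu>" using \<nu>(3) by blast
    moreover have "the_inv_into (K - {i0}) q (q i) = i"
      using the_inv_into_f_f[OF inj] that False by simp
    ultimately show ?thesis using B(2)[of "q i"] by (simp add: f_def)
  qed
  have Bn: "B \<nu> = 0" using B(2)[of \<nu>] by (simp add: f_def)
  define n where "n = inverse (norm \<nu>) *\<^sub>R \<nu>"
  have nn: "n \<bullet> n = 1" using \<nu>(1) by (simp add: n_def dot_square_norm power2_eq_square)
  have nq: "n \<bullet> q i = 0" if "i \<in> K" for i using \<nu>(2)[OF that] by (simp add: n_def)
  have Bn': "B n = 0" unfolding n_def using Bn B(1) by (simp add: linear_cmul)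
  define w where "w = adjoint B n"
  have w: "w \<bullet> x = n \<bullet> B x" for x
    unfolding w_def using adjoint_works[OF B(1), of x n] by (simp add: inner_commute)
  define h where "h x = B x - (n \<bullet> x) *\<^sub>R w" for x
  have lin: "linear h" unfolding h_def
    by (intro linear_compose_sub B(1)) (auto intro!: linearI simp: inner_add_right algebra_simps)
  have hq: "h (q i) = m i - m i0" if "i \<in> K" for i
    using that Bq nq by (simp add: h_def)
  have hn: "h n = - w" using nn Bn' by (simp add: h_def)
  have nu_n: "\<nu> = norm \<nu> *\<^sub>R n" using \<nu>(1) by (simp add: n_def)
  have span': "x \<in> span (insert n Q)" for x
  proof -
    have "\<nu> \<in> span (insert n Q)" by (subst nu_n) (intro span_scale span_base, simp)
    then have "insert \<nu> Q \<subseteq> span (insert n Q)" using span_superset[of "insert n Q"] by auto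
    then have "span (insert \<nu> Q) \<subseteq> span (insert n Q)" by (rule span_minimal) simp
    then show ?thesis using \<nu>(5) by blast
  qed
  have base: "x \<bullet> h y + y \<bullet> h x = 0" if "x \<in> insert n Q" "y \<in> insert n Q" for x y
  proof -
    have wn: "n \<bullet> w = 0" using w[of n] Bn' by (simp add: inner_commute)
    have wq: "q i \<bullet> w = n \<bullet> h (q i)" if "i \<in> K" for i
      using w[of "q i"] Bq[OF that] hq[OF that] by (simp add: inner_commute)
    have qq: "q i \<bullet> h (q j) + q j \<bullet> h (q i) = 0" if "i \<in> K" "j \<in> K" for i j
    proof -
      have "q i \<bullet> (m j - m i0) + q j \<bullet> (m i - m i0) = 0"
        using mot[OF that] mot[OF that(1) i0] mot[OF that(2) i0]
        by (simp add: q_def inner_diff_left inner_diff_right)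
      then show ?thesis by (simp add: hq that)
    qed
    from that show ?thesis unfolding Q_def
      by (auto simp: hn wn wq qq)
  qed
  have step: "x \<bullet> h y + y \<bullet> h x = 0" if "x \<in> insert n Q" for x y
    using span'[of y]
  proof (induction rule: span_induct)
    show "subspace {y. x \<bullet> h y + y \<bullet> h x = 0}"
      using lin by (auto simp: subspace_def linear_0 linear_add linear_cmul inner_add_left
          inner_add_right simp flip: distrib_left)
  qed (use base that in auto)
  have skew: "x \<bullet> h y + y \<bullet> h x = 0" for x y
    using span'[of x]
  proof (induction rule: span_induct)
    show "subspace {x. x \<bullet> h y + y \<bullet> h x = 0}"
      using lin by (auto simp: subspace_def linear_0 linear_add linear_cmul inner_add_left
          inner_add_right simp flip: distrib_left)
  qed (use step in auto)
  define A where "A = matrix h"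
  have A: "A *v x = h x" for x unfolding A_def using lin by (simp add: matrix_works)
  have comp: "A $ i $ j = axis i 1 \<bullet> h (axis j 1)" for i j
    by (simp add: A_def matrix_def inner_axis')
  have "transpose A = - A"
    by (simp add: vec_eq_iff transpose_def comp) (use skew in \<open>simp add: eq_neg_iff_add_eq_0\<close>)
  moreover have "m i = A *v p i + (m i0 - A *v p i0)" if "i \<in> K" for i
    using hq[OF that] by (simp add: A q_def linear_diff[OF lin] algebra_simps)
  ultimately show ?thesis by blast
qed

text \<open>
  Rigidity can be tested on the motions that vanish on a fixed clique.  This removes the trivial
  motions by a condition that does not depend on the placement.
\<close>

lemma rigid_iff_pinned:
  fixes p :: "'v \<Rightarrow> real^'n"
  assumes "K \<subseteq> fst G" "finite K" "card K = CARD('n)" "affind K p"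
    and clique: "\<And>i j. i \<in> K \<Longrightarrow> j \<in> K \<Longrightarrow> i \<noteq> j \<Longrightarrow> {i, j} \<in> snd G"
  shows "infinitesimally_rigid G p \<longleftrightarrow>
    (\<forall>m. infinitesimal_motion G p m \<and> (\<forall>i\<in>K. m i = 0) \<longrightarrow> (\<forall>i\<in>fst G. m i = 0))"
proof (intro iffI allI impI)
  fix m assume "infinitesimally_rigid G p" and m: "infinitesimal_motion G p m \<and> (\<forall>i\<in>K. m i = 0)"
  then obtain A t where A: "transpose A = - A" "\<forall>i\<in>fst G. m i = A *v p i + t"
    unfolding infinitesimally_rigid_def trivial_motion_def by blast
  have "A *v p i + t = 0" if "i \<in> K" for i using A(2) m assms(1) that by (metis subsetD)
  from trivial_motion_vanishing[OF assms(4,2,3) A(1) this] A(2)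
  show "\<forall>i\<in>fst G. m i = 0" by simp
next
  assume pin: "\<forall>m. infinitesimal_motion G p m \<and> (\<forall>i\<in>K. m i = 0) \<longrightarrow> (\<forall>i\<in>fst G. m i = 0)"
  show "infinitesimally_rigid G p"
    unfolding infinitesimally_rigid_def
  proof (intro allI impI)
    fix m assume m: "infinitesimal_motion G p m"
    have "(p i - p j) \<bullet> (m i - m j) = 0" if "i \<in> K" "j \<in> K" for i j
      using m clique[OF that] by (cases "i = j") (auto simp: infinitesimal_motion_def)
    from skew_extension[OF assms(4,2,3) this] obtain A t where
      A: "transpose A = - A" "\<forall>i\<in>K. m i = A *v p i + t" by blast
    define m' where "m' i = m i - (A *v p i + t)" for i
    have "infinitesimal_motion G p m'"
      unfolding infinitesimal_motion_def
    proof (intro allI impI)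
      fix i j assume "{i, j} \<in> snd G"
      then have "(p i - p j) \<bullet> (m i - m j) = 0" using m by (simp add: infinitesimal_motion_def)
      moreover have "(p i - p j) \<bullet> (A *v (p i - p j)) = 0"
        using skew_inner[OF A(1), of "p i - p j" "p i - p j"] by (simp add: inner_commute)
      moreover have "m' i - m' j = (m i - m j) - A *v (p i - p j)"
        by (simp add: m'_def matrix_vector_mult_diff_distrib)
      ultimately show "(p i - p j) \<bullet> (m' i - m' j) = 0" by (simp add: inner_diff_right)
    qed
    moreover have "\<forall>i\<in>K. m' i = 0" using A(2) by (simp add: m'_def)
    ultimately have "\<forall>i\<in>fst G. m' i = 0" using pin by blast
    then show "trivial_motion G p m"
      unfolding trivial_motion_def using A(1) by (intro exI[of _ A] exI[of _ t]) (simp add: m'_def)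
  qed
qed

section \<open>Pinned frameworks and vertex splitting\<close>

text \<open>
  Every motion that vanishes on \<open>K\<close> vanishes on all vertices.
\<close>

definition pinned :: "'v graph \<Rightarrow> 'v set \<Rightarrow> ('v \<Rightarrow> real^'n) \<Rightarrow> bool" where
  "pinned G K p \<longleftrightarrow>
    (\<forall>m. infinitesimal_motion G p m \<and> (\<forall>i\<in>K. m i = 0) \<longrightarrow> (\<forall>i\<in>fst G. m i = 0))"

lemma affind_line:
  fixes p q :: "'v \<Rightarrow> real^'n"
  assumes "finite K" "affind K q"
  shows "finite {s. \<not> affind K (\<lambda>x. q x + s *\<^sub>R (p x - q x))}"
proof -
  define a b :: "unit \<Rightarrow> ('v \<Rightarrow> real) \<Rightarrow> (real^'n) \<times> real" where
    "a = (\<lambda>_ c. ((\<Sum>i\<in>K. c i *\<^sub>R q i), (\<Sum>i\<in>K. c i)))" and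
    "b = (\<lambda>_ c. ((\<Sum>i\<in>K. c i *\<^sub>R (p i - q i)), 0))"
  have "finite {s. \<exists>c. (\<forall>x. x \<notin> K \<longrightarrow> c x = 0) \<and> c \<noteq> (\<lambda>_. 0) \<and>
            (\<forall>i. a i c + s *\<^sub>R b i c = 0)}"
  proof (rule pencil_finite[OF assms(1)])
    show "fun_linear (a i)" "fun_linear (b i)" for i
      by (simp_all add: fun_linear_def a_def b_def scaleR_left_distrib sum.distrib
          scaleR_sum_right sum_distrib_left)
    fix c assume c: "\<And>x. x \<notin> K \<Longrightarrow> c x = 0" "\<And>i. a i c = 0"
    have "\<forall>i\<in>K. c i = 0" using assms(2) c(2)[of "()"] by (simp add: affind_def a_def zero_prod_def)
    with c(1) show "c = (\<lambda>_. 0)" by (intro ext) blast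
  qed
  moreover have "{s. \<not> affind K (\<lambda>x. q x + s *\<^sub>R (p x - q x))} \<subseteq>
    {s. \<exists>c. (\<forall>x. x \<notin> K \<longrightarrow> c x = 0) \<and> c \<noteq> (\<lambda>_. 0) \<and> (\<forall>i. a i c + s *\<^sub>R b i c = 0)}"
  proof
    fix s assume "s \<in> {s. \<not> affind K (\<lambda>x. q x + s *\<^sub>R (p x - q x))}"
    then obtain c j where c: "(\<Sum>i\<in>K. c i *\<^sub>R (q i + s *\<^sub>R (p i - q i))) = 0"
      "(\<Sum>i\<in>K. c i) = 0" "j \<in> K" "c j \<noteq> 0"
      unfolding affind_def by blast
    define c' where "c' i = (if i \<in> K then c i else 0)" for i
    have "a () c' + s *\<^sub>R b () c' = ((\<Sum>i\<in>K. c i *\<^sub>R (q i + s *\<^sub>R (p i - q i))), (\<Sum>i\<in>K. c i))"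
      by (simp add: a_def b_def c'_def scaleR_right_distrib sum.distrib scaleR_sum_right mult.commute)
    then have "\<forall>i. a i c' + s *\<^sub>R b i c' = 0" using c by (simp add: zero_prod_def)
    moreover have "c' j \<noteq> 0" using c by (simp add: c'_def)
    then have "c' \<noteq> (\<lambda>_. 0)" by metis
    moreover have "\<forall>x. x \<notin> K \<longrightarrow> c' x = 0" by (simp add: c'_def)
    ultimately show "s \<in> {s. \<exists>c. (\<forall>x. x \<notin> K \<longrightarrow> c x = 0) \<and> c \<noteq> (\<lambda>_. 0) \<and>
        (\<forall>i. a i c + s *\<^sub>R b i c = 0)}" by blast
  qed
  ultimately show ?thesis by (rule rev_finite_subset)
qed

lemma pinned_line:
  fixes p q :: "'v \<Rightarrow> real^'n"
  assumes "finite V" and E: "\<And>i j. {i, j} \<in> E \<Longrightarrow> i \<in> V \<and> j \<in> V"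
    and q: "pinned (V, E) K q"
  shows "finite {s. \<not> pinned (V, E) K (\<lambda>x. q x + s *\<^sub>R (p x - q x))}"
proof -
  define a b :: "'v \<times> 'v \<Rightarrow> ('v \<Rightarrow> real^'n) \<Rightarrow> real" where
    "a = (\<lambda>(i, j) m. if {i, j} \<in> E then (q i - q j) \<bullet> (m i - m j) else 0)" and
    "b = (\<lambda>(i, j) m. if {i, j} \<in> E then ((p i - q i) - (p j - q j)) \<bullet> (m i - m j) else 0)"
  let ?bad = "{s. \<exists>m. (\<forall>x. x \<notin> V - K \<longrightarrow> m x = 0) \<and> m \<noteq> (\<lambda>_. 0) \<and>
            (\<forall>i. a i m + s *\<^sub>R b i m = 0)}"
  have "finite ?bad"
  proof (rule pencil_finite)
    show "finite (V - K)" using assms(1) by simp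
    show "fun_linear (a i)" "fun_linear (b i)" for i
      by (cases i; simp add: fun_linear_def a_def b_def inner_add_right inner_diff_right
          right_diff_distrib)+
    fix m assume m: "\<And>x. x \<notin> V - K \<Longrightarrow> m x = 0" "\<And>i. a i m = 0"
    have "(q i - q j) \<bullet> (m i - m j) = 0" if "{i, j} \<in> E" for i j
      using m(2)[of "(i, j)"] that by (simp add: a_def)
    then have "infinitesimal_motion (V, E) q m" by (simp add: infinitesimal_motion_def)
    moreover have "\<forall>i\<in>K. m i = 0" using m(1) by blast
    ultimately have "\<forall>i\<in>V. m i = 0" using q unfolding pinned_def fst_conv by blast
    with m(1) show "m = (\<lambda>_. 0)" by (intro ext) blast
  qed
  moreover have "{s. \<not> pinned (V, E) K (\<lambda>x. q x + s *\<^sub>R (p x - q x))} \<subseteq> ?bad"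
  proof
    fix s assume "s \<in> {s. \<not> pinned (V, E) K (\<lambda>x. q x + s *\<^sub>R (p x - q x))}"
    then obtain m j where m: "infinitesimal_motion (V, E) (\<lambda>x. q x + s *\<^sub>R (p x - q x)) m"
      "\<forall>i\<in>K. m i = 0" "j \<in> V" "m j \<noteq> 0"
      unfolding pinned_def by auto
    define m' where "m' i = (if i \<in> V then m i else 0)" for i
    have "a (i, j) m' + s *\<^sub>R b (i, j) m' = 0" for i j
    proof (cases "{i, j} \<in> E")
      case True
      then have "((q i + s *\<^sub>R (p i - q i)) - (q j + s *\<^sub>R (p j - q j))) \<bullet> (m i - m j) = 0"
        using m(1) by (simp add: infinitesimal_motion_def)
      moreover have "(q i + s *\<^sub>R (p i - q i)) - (q j + s *\<^sub>R (p j - q j)) =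
          (q i - q j) + s *\<^sub>R ((p i - q i) - (p j - q j))"
        by (simp add: algebra_simps)
      moreover have "m' i = m i" "m' j = m j" using E[OF True] by (auto simp: m'_def)
      ultimately show ?thesis using True by (simp add: a_def b_def inner_add_left)
    qed (simp add: a_def b_def)
    then have "\<forall>i. a i m' + s *\<^sub>R b i m' = 0" by (metis surj_pair)
    moreover have "m' j \<noteq> 0" using m by (simp add: m'_def)
    then have "m' \<noteq> (\<lambda>_. 0)" by metis
    moreover have "\<forall>x. x \<notin> V - K \<longrightarrow> m' x = 0" using m(2) by (simp add: m'_def)
    ultimately show "s \<in> ?bad" by blast
  qed
  ultimately show ?thesis by (rule rev_finite_subset)
qed

text \<open>
  Vertex splitting.  The edges of \<open>(V', E')\<close> arise from those of \<open>(V, E)\<close> by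
  identifying \<open>v\<close> with \<open>u\<close>.  If \<open>u\<close> and \<open>v\<close> have \<open>CARD('n) - 1\<close> common neighbours \<open>N\<close>, in general position
  with respect to \<open>u\<close>, then a pinned placement of \<open>(V', E')\<close> gives one of \<open>(V, E)\<close> with
  the edge \<open>uv\<close> by moving \<open>v\<close> only.
\<close>

lemma vertex_split:
  fixes p :: "'v \<Rightarrow> real^'n"
  assumes "finite V" and E: "\<And>i j. {i, j} \<in> E \<Longrightarrow> i \<in> V \<and> j \<in> V \<and> i \<noteq> j"
    and "{u, v} \<notin> E" "u \<noteq> v" "u \<in> V'" "u \<in> V" "v \<in> V" "v \<notin> K" "V \<subseteq> insert v V'"
    and E': "\<And>i j. {i, j} \<in> E' \<Longrightarrow> i \<noteq> v \<and> j \<noteq> v \<and>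
      ({i, j} \<in> E \<or> i = u \<and> {v, j} \<in> E \<or> j = u \<and> {i, v} \<in> E)"
    and p: "pinned (V', E') K p"
    and N: "finite N" "u \<notin> N" "card N + 1 = CARD('n)" "affind (insert u N) p"
      "\<And>y. y \<in> N \<Longrightarrow> {u, y} \<in> E \<and> {v, y} \<in> E"
  shows "\<exists>w. pinned (V, insert {u, v} E) K (p(v := w))"
proof -
  \<comment> \<open>In the degenerate placement \<open>p0\<close>, where \<open>v\<close> sits on \<open>u\<close>, the edge \<open>uv\<close> is replaced by the condition \<open>z \<bullet> (m u - m v) = 0\<close>; the placements \<open>p0 + t d\<close> move \<open>v\<close> in direction \<open>z\<close>.\<close>
  define p0 where "p0 = p(v := p u)"
  have "finite (insert u N)" "card (insert u N) = CARD('n)" using N by simp_all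
  then obtain z where z: "span (insert z ((\<lambda>i. p i - p u) ` (insert u N - {u}))) = UNIV"
    using affind_normal[OF N(4) _ insertI1] by metis
  define d where "d = (\<lambda>_. 0)(v := z)"
  define a b :: "'v \<times> 'v \<Rightarrow> ('v \<Rightarrow> real^'n) \<Rightarrow> real" where
    "a = (\<lambda>(i, j) m. if {i, j} \<in> E then (p0 i - p0 j) \<bullet> (m i - m j)
                     else if {i, j} = {u, v} then z \<bullet> (m i - m j) else 0)" and
    "b = (\<lambda>(i, j) m. if {i, j} \<in> E then (d i - d j) \<bullet> (m i - m j) else 0)"
  let ?bad = "{s. \<exists>m. (\<forall>x. x \<notin> V - K \<longrightarrow> m x = 0) \<and> m \<noteq> (\<lambda>_. 0) \<and>
            (\<forall>i. a i m + s *\<^sub>R b i m = 0)}"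
  have "finite ?bad"
  proof (rule pencil_finite)
    show "finite (V - K)" using assms(1) by simp
    show "fun_linear (a i)" "fun_linear (b i)" for i
      by (cases i; simp add: fun_linear_def a_def b_def inner_add_right inner_diff_right
          right_diff_distrib)+
    fix m assume m: "\<And>x. x \<notin> V - K \<Longrightarrow> m x = 0" "\<And>i. a i m = 0"
    have me: "(p0 i - p0 j) \<bullet> (m i - m j) = 0" if "{i, j} \<in> E" for i j
      using m(2)[of "(i, j)"] that by (simp add: a_def)
    \<comment> \<open>At \<open>t = 0\<close> the common neighbours and the direction \<open>z\<close> force \<open>u\<close> and \<open>v\<close> to move alike.\<close>
    have "m u - m v = 0"
    proof (rule span_inner_eq_0[OF _ z])
      fix y assume "y \<in> insert z ((\<lambda>i. p i - p u) ` (insert u N - {u}))"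
      then consider "y = z" | i where "i \<in> N" "y = p i - p u" by blast
      then show "(m u - m v) \<bullet> y = 0"
      proof cases
        case 1
        then show ?thesis using m(2)[of "(u, v)"] assms(3)
          by (simp add: a_def inner_commute)
      next
        case 2
        have "i \<noteq> v" using N(5)[OF 2(1)] E by blast
        then have "p0 i = p i" "p0 v = p u" "p0 u = p u" using assms(4) by (auto simp: p0_def)
        then have "(p u - p i) \<bullet> (m u - m i) = 0" "(p u - p i) \<bullet> (m v - m i) = 0"
          using me[of u i] me[of v i] N(5)[OF 2(1)] by simp_all
        then show ?thesis using 2
          by (simp add: inner_diff_left inner_diff_right inner_commute)
      qed
    qed
    then have muv: "m u = m v" by simp
    have "infinitesimal_motion (V', E') p m"
      unfolding infinitesimal_motion_def snd_conv
    proof (intro allI impI)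
      fix i j assume e: "{i, j} \<in> E'"
      have ij: "p0 i = p i" "p0 j = p j" using E'[OF e] by (simp_all add: p0_def)
      have pu: "p0 v = p u" by (simp add: p0_def)
      from E'[OF e] consider "{i, j} \<in> E" | "i = u" "{v, j} \<in> E" | "j = u" "{i, v} \<in> E" by blast
      then show "(p i - p j) \<bullet> (m i - m j) = 0"
      proof cases
        case 1 then show ?thesis using me[of i j] ij by simp
      next
        case 2 then show ?thesis using me[of v j] ij pu muv by simp
      next
        case 3 then show ?thesis using me[of i v] ij pu muv by simp
      qed
    qed
    moreover have "\<forall>i\<in>K. m i = 0" using m(1) by blast
    ultimately have V': "\<forall>i\<in>V'. m i = 0" using p unfolding pinned_def fst_conv by blast
    moreover have "m v = 0" using V' muv assms(5) by metis
    ultimately show "m = (\<lambda>_. 0)" using m(1) assms(9) by (intro ext) blast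
  qed
  then have "finite (insert 0 ?bad)" by simp
  then obtain t where t: "t \<notin> ?bad" "t \<noteq> 0"
    using ex_new_if_finite[OF infinite_UNIV_char_0] by (metis (no_types, lifting) insertCI)
  define w where "w = p u + t *\<^sub>R z"
  have line: "(p(v := w)) x = p0 x + t *\<^sub>R d x" for x by (simp add: w_def p0_def d_def)
  have "pinned (V, insert {u, v} E) K (p(v := w))"
    unfolding pinned_def fst_conv
  proof (intro allI impI)
    fix m assume m: "infinitesimal_motion (V, insert {u, v} E) (p(v := w)) m \<and> (\<forall>i\<in>K. m i = 0)"
    define m' where "m' i = (if i \<in> V then m i else 0)" for i
    have mot: "((p0 i + t *\<^sub>R d i) - (p0 j + t *\<^sub>R d j)) \<bullet> (m' i - m' j) = 0"
      if e: "{i, j} \<in> insert {u, v} E" for i j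
    proof -
      have "i \<in> V" "j \<in> V" using e E assms(6,7) by (auto simp: doubleton_eq_iff)
      moreover have "((p0 i + t *\<^sub>R d i) - (p0 j + t *\<^sub>R d j)) \<bullet> (m i - m j) = 0"
        using m e unfolding infinitesimal_motion_def snd_conv line by blast
      ultimately show ?thesis by (simp add: m'_def)
    qed
    have "a (i, j) m' + t *\<^sub>R b (i, j) m' = 0" for i j
    proof (cases "{i, j} \<in> E")
      case True
      have "(p0 i + t *\<^sub>R d i) - (p0 j + t *\<^sub>R d j) = (p0 i - p0 j) + t *\<^sub>R (d i - d j)"
        by (simp add: algebra_simps)
      with mot[of i j] True show ?thesis by (simp add: a_def b_def inner_add_left)
    next
      case False
      have "z \<bullet> (m' i - m' j) = 0" if "{i, j} = {u, v}"
      proof -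
        have "((p0 u + t *\<^sub>R d u) - (p0 v + t *\<^sub>R d v)) \<bullet> (m' u - m' v) = 0"
          by (rule mot) simp
        then have "z \<bullet> (m' u - m' v) = 0"
          using assms(4) \<open>t \<noteq> 0\<close> by (simp add: p0_def d_def)
        moreover from that have "i = u \<and> j = v \<or> i = v \<and> j = u" by (simp add: doubleton_eq_iff)
        ultimately show ?thesis by (auto simp: inner_diff_right)
      qed
      then show ?thesis using False by (simp add: a_def b_def)
    qed
    then have "\<forall>i. a i m' + t *\<^sub>R b i m' = 0" by (metis surj_pair)
    moreover have "\<forall>x. x \<notin> V - K \<longrightarrow> m' x = 0" using m by (simp add: m'_def)
    ultimately have "m' = (\<lambda>_. 0)" using t(1) by blast
    then show "\<forall>i\<in>V. m i = 0" unfolding m'_def fun_eq_iff by metis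
  qed
  then show ?thesis by blast
qed

section \<open>Generic symmetric placements\<close>

lemma affind_affine_independent:
  fixes h :: "'v \<Rightarrow> real^'n"
  assumes "finite J" "inj_on h J" "h ` J \<subseteq> T" "\<not> affine_dependent T"
  shows "affind J h"
  unfolding affind_def
proof (intro allI impI, rule ccontr)
  fix c assume c: "(\<Sum>i\<in>J. c i *\<^sub>R h i) = 0 \<and> (\<Sum>i\<in>J. c i) = 0" "\<not> (\<forall>i\<in>J. c i = 0)"
  define U where "U = (\<lambda>x. c (the_inv_into J h x))"
  have U: "U (h i) = c i" if "i \<in> J" for i
    using that assms(2) by (simp add: U_def the_inv_into_f_f)
  have "(\<Sum>x\<in>h ` J. U x) = 0" "(\<Sum>x\<in>h ` J. U x *\<^sub>R x) = 0"
    using c(1) U by (simp_all add: sum.reindex[OF assms(2)])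
  moreover have "\<exists>x\<in>h ` J. U x \<noteq> 0" using c(2) U by auto
  ultimately have "affine_dependent T"
    unfolding affine_dependent_explicit using assms(1,3) by blast
  with assms(4) show False by contradiction
qed

text \<open>
  A pairing on \<open>X\<close> and a non-trivial linear involution \<open>g\<close>.  The set \<open>X\<close> stays the same
  throughout the induction on circuits: a partner need not be a vertex of the graph considered.
  Orthogonality of \<open>g\<close> is not needed.
\<close>

locale symmetric_pairing =
  fixes X :: "'v set" and star :: "'v \<Rightarrow> 'v" and g :: "real^'n^'n" and k :: nat
  assumes finite_X: "finite X"
    and star_in: "x \<in> X \<Longrightarrow> star x \<in> X"
    and star_star: "x \<in> X \<Longrightarrow> star (star x) = x"
    and star_neq: "x \<in> X \<Longrightarrow> star x \<noteq> x"
    and invol: "g ** g = mat 1" and g_neq: "g \<noteq> mat 1"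
    and dim: "CARD('n) = k + 1" and k2: "2 \<le> k" and card_X: "card X \<le> 2 * k"
begin

text \<open>
  Placements compatible with the pairing.
\<close>

definition symmetric :: "('v \<Rightarrow> real^'n) \<Rightarrow> bool" where
  "symmetric p \<longleftrightarrow> (\<forall>u\<in>X. p (star u) = g *v p u)"

text \<open>
  A condition is generic if some symmetric placement satisfies it and it fails at only finitely
  many points of any line of placements through a point where it holds.
\<close>

definition generic :: "(('v \<Rightarrow> real^'n) \<Rightarrow> bool) \<Rightarrow> bool" where
  "generic Q \<longleftrightarrow> (\<exists>q. symmetric q \<and> Q q) \<and>
     (\<forall>p q. Q q \<longrightarrow> finite {s. \<not> Q (\<lambda>x. q x + s *\<^sub>R (p x - q x))})"

lemma gg: "g *v (g *v x) = x"
  by (simp add: matrix_vector_mul_assoc invol)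

lemma symmetric_line:
  assumes "symmetric p" "symmetric q"
  shows "symmetric (\<lambda>x. q x + s *\<^sub>R (p x - q x))"
  using assms
  by (simp add: symmetric_def matrix_vector_right_distrib matrix_vector_mult_diff_distrib
      matrix_vector_mult_scaleR)

lemma genericI:
  assumes "symmetric q" "Q q"
    and "\<And>p q. Q q \<Longrightarrow> finite {s. \<not> Q (\<lambda>x. q x + s *\<^sub>R (p x - q x))}"
  shows "generic Q"
  using assms unfolding generic_def by blast

lemma generic_True: "generic (\<lambda>_. True)"
  by (rule genericI[of "\<lambda>_. 0"]) (simp_all add: symmetric_def)

lemma generic_conj:
  assumes "generic P" "generic Q"
  shows "generic (\<lambda>p. P p \<and> Q p)"
proof -
  obtain p q where pq: "symmetric p" "P p" "symmetric q" "Q q"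
    using assms unfolding generic_def by blast
  define B where "B = {s. \<not> P (\<lambda>x. p x + s *\<^sub>R (q x - p x))}"
  define C where "C = {s. \<not> Q (\<lambda>x. q x + s *\<^sub>R (p x - q x))}"
  have "finite B" "finite C" using assms pq unfolding generic_def B_def C_def by blast+
  then have "finite (B \<union> (\<lambda>s. 1 - s) ` C)" by simp
  then obtain s where s: "s \<notin> B \<union> (\<lambda>s. 1 - s) ` C"
    using ex_new_if_finite[OF infinite_UNIV_char_0] by metis
  then have "1 - s \<notin> C" by (metis UnI2 diff_diff_eq2 add_diff_cancel_left' image_eqI)
  moreover have "(\<lambda>x. q x + (1 - s) *\<^sub>R (p x - q x)) = (\<lambda>x. p x + s *\<^sub>R (q x - p x))"
    by (rule ext) (simp add: algebra_simps)
  ultimately have "Q (\<lambda>x. p x + s *\<^sub>R (q x - p x))" unfolding C_def by simp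
  moreover have "P (\<lambda>x. p x + s *\<^sub>R (q x - p x))" using s unfolding B_def by simp
  moreover have "symmetric (\<lambda>x. p x + s *\<^sub>R (q x - p x))" using pq by (simp add: symmetric_line)
  moreover have "finite {s. \<not> (P (\<lambda>x. q x + s *\<^sub>R (p x - q x)) \<and> Q (\<lambda>x. q x + s *\<^sub>R (p x - q x)))}"
    if "P q \<and> Q q" for p q
  proof -
    have "finite ({s. \<not> P (\<lambda>x. q x + s *\<^sub>R (p x - q x))} \<union> {s. \<not> Q (\<lambda>x. q x + s *\<^sub>R (p x - q x))})"
      using assms that unfolding generic_def by blast
    then show ?thesis by (rule rev_finite_subset) blast
  qed
  ultimately show ?thesis unfolding generic_def by blast
qed

lemma generic_Ball:
  assumes "finite I" "\<And>i. i \<in> I \<Longrightarrow> generic (Q i)"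
  shows "generic (\<lambda>p. \<forall>i\<in>I. Q i p)"
  using assms
proof (induction I rule: finite_induct)
  case empty
  show ?case using generic_True by simp
next
  case (insert i I)
  have "generic (\<lambda>p. Q i p \<and> (\<forall>i\<in>I. Q i p))"
    using insert by (intro generic_conj) simp_all
  then show ?case by simp
qed

lemma moved_point: "\<exists>z. g *v z \<noteq> z"
  using g_neq by (metis matrix_eq matrix_vector_mul_lid)

text \<open>
  The set \<open>J\<close> contains at most one pair.
\<close>

definition few_pairs :: "'v set \<Rightarrow> bool" where
  "few_pairs J \<longleftrightarrow> (\<forall>x\<in>X \<inter> J. \<forall>y\<in>X \<inter> J. star x \<in> J \<longrightarrow> star y \<in> J \<longrightarrow> y = x \<or> y = star x)"

text \<open>
  The points are taken from an affine basis that contains \<open>z\<close> and \<open>g *v z\<close> for a point \<open>z\<close>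
  moved by \<open>g\<close>; these two serve for the pair in \<open>J\<close>, if there is one.
\<close>

lemma affind_feasible:
  assumes "finite J" "card J \<le> k + 1" "few_pairs J"
  shows "\<exists>p. symmetric p \<and> affind J p"
proof -
  obtain z where z: "g *v z \<noteq> z" using moved_point by blast
  have "\<not> affine_dependent {z, g *v z}" by simp
  then obtain T where T: "\<not> affine_dependent T" "{z, g *v z} \<subseteq> T" "affine hull T = affine hull UNIV"
    using extend_to_affine_basis[of "{z, g *v z}" UNIV] by auto
  have finT: "finite T" using T(1) by (rule aff_independent_finite)
  have "aff_dim T = DIM(real^'n)"
    using T(3) by (metis aff_dim_affine_hull aff_dim_UNIV)
  then have cT: "card T = k + 2"
    using aff_dim_affine_independent[OF T(1)] dim by simp
  obtain h where h: "inj_on h J" "h ` J \<subseteq> T"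
    "\<And>x. x \<in> X \<Longrightarrow> x \<in> J \<Longrightarrow> star x \<in> J \<Longrightarrow> h (star x) = g *v h x"
  proof (cases "\<exists>a. a \<in> X \<and> a \<in> J \<and> star a \<in> J")
    case False
    have "card J \<le> card T" using assms(2) cT by simp
    from card_le_inj[OF assms(1) finT this] that False show ?thesis by blast
  next
    case True
    then obtain a where a: "a \<in> X" "a \<in> J" "star a \<in> J" by blast
    have an: "star a \<noteq> a" using star_neq a by blast
    have "card (J - {a, star a}) \<le> card (T - {z, g *v z})"
      using assms(1,2) a an z T(2) cT finT by (simp add: card_Diff_subset)
    then obtain f where f: "f ` (J - {a, star a}) \<subseteq> T - {z, g *v z}" "inj_on f (J - {a, star a})"
      using card_le_inj[of "J - {a, star a}" "T - {z, g *v z}"] assms(1) finT by auto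
    define h where "h x = (if x = a then z else if x = star a then g *v z else f x)" for x
    show ?thesis
    proof (rule that[of h])
      show "inj_on h J"
      proof (rule inj_onI)
        fix x y assume xy: "x \<in> J" "y \<in> J" "h x = h y"
        have fx: "f x \<noteq> z" "f x \<noteq> g *v z" if "x \<in> J" "x \<noteq> a" "x \<noteq> star a" for x
          using f(1) that by blast+
        have ff: "x = y" if "x \<noteq> a" "x \<noteq> star a" "y \<noteq> a" "y \<noteq> star a" "f x = f y"
          using f(2) that xy unfolding inj_on_def by blast
        show "x = y" using xy z fx[of x] fx[of y] ff unfolding h_def by (metis (full_types))
      qed
      show "h ` J \<subseteq> T" using f(1) T(2) by (auto simp: h_def)
      fix x assume x: "x \<in> X" "x \<in> J" "star x \<in> J"
      then have "x = a \<or> x = star a" using assms(3) a unfolding few_pairs_def by blast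
      then show "h (star x) = g *v h x"
        using star_star[OF a(1)] an by (auto simp: h_def gg)
    qed
  qed
  \<comment> \<open>Partners outside \<open>J\<close> of members of \<open>J\<close> are placed as the symmetry dictates.\<close>
  define p where "p x = (if x \<in> J then h x else if x \<in> X \<and> star x \<in> J then g *v h (star x) else 0)" for x
  have "symmetric p"
    unfolding symmetric_def
  proof
    fix u assume u: "u \<in> X"
    then show "p (star u) = g *v p u"
      using h(3)[of u] star_in[OF u] star_star[OF u] by (simp add: p_def gg)
  qed
  moreover have "affind J h" using affind_affine_independent[OF assms(1) h(1,2) T(1)] .
  then have "affind J p" using affind_cong[of J p h] by (simp add: p_def)
  ultimately show ?thesis by blast
qed

lemma generic_affind:
  assumes "finite J" "card J \<le> k + 1" "few_pairs J"
  shows "generic (affind J)"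
proof -
  obtain q where "symmetric q" "affind J q" using affind_feasible[OF assms] by blast
  then show ?thesis by (rule genericI) (rule affind_line[OF assms(1)])
qed

lemma generic_rigid:
  assumes "finite V" and E: "\<And>i j. {i, j} \<in> E \<Longrightarrow> i \<in> V \<and> j \<in> V"
    and K: "K \<subseteq> V" "card K = k + 1"
    and clique: "\<And>i j. i \<in> K \<Longrightarrow> j \<in> K \<Longrightarrow> i \<noteq> j \<Longrightarrow> {i, j} \<in> E"
    and q: "symmetric q" "affind K q" "infinitesimally_rigid (V, E) q"
  shows "generic (\<lambda>p. affind K p \<and> infinitesimally_rigid (V, E) p)"
proof -
  have finK: "finite K" using K assms(1) finite_subset by blast
  have eq: "(affind K p \<and> infinitesimally_rigid (V, E) p) = (affind K p \<and> pinned (V, E) K p)" for p :: "'v \<Rightarrow> real^'n"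
    using rigid_iff_pinned[of K "(V, E)" p] K finK clique dim unfolding pinned_def by auto
  have "finite {s. \<not> (affind K (\<lambda>x. q x + s *\<^sub>R (p x - q x)) \<and>
      pinned (V, E) K (\<lambda>x. q x + s *\<^sub>R (p x - q x)))}"
    if "affind K q \<and> pinned (V, E) K q" for p q
  proof -
    have "finite ({s. \<not> affind K (\<lambda>x. q x + s *\<^sub>R (p x - q x))} \<union>
      {s. \<not> pinned (V, E) K (\<lambda>x. q x + s *\<^sub>R (p x - q x))})"
      using affind_line[OF finK, of q p] pinned_line[OF assms(1) E, of E K q p] that by blast
    then show ?thesis by (rule rev_finite_subset) blast
  qed
  then show ?thesis unfolding eq using q eq by (intro genericI[of q]) blast+
qed

end

section \<open>Contracting an edge of a circuit\<close>

text \<open>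
  The \<open>1\<close>-faces of a set system.
\<close>

definition edges :: "'v set set \<Rightarrow> 'v set set" where
  "edges C = {e. card e = 2 \<and> (\<exists>K\<in>C. e \<subseteq> K)}"

lemma edge_iff: "{i, j} \<in> edges C \<longleftrightarrow> i \<noteq> j \<and> (\<exists>K\<in>C. i \<in> K \<and> j \<in> K)"
proof -
  have "card {i, j} = 2 \<longleftrightarrow> i \<noteq> j" by (cases "i = j") simp_all
  then show ?thesis unfolding edges_def by simp
qed

lemma edges_mono: "D \<subseteq> C \<Longrightarrow> edges D \<subseteq> edges C"
  unfolding edges_def by blast

text \<open>
  The family \<open>f K\<close> for \<open>K\<close> in \<open>D\<close>, repetitions included, is a \<open>k\<close>-cycle.  With
  \<open>f = id\<close> this says that the set system \<open>D\<close> itself is a cycle; with \<open>f\<close> a contraction it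
  speaks of the contracted multicomplex without forming a multiset.
\<close>

definition cycle_along :: "nat \<Rightarrow> ('v set \<Rightarrow> 'v set) \<Rightarrow> 'v set set \<Rightarrow> bool" where
  "cycle_along k f D \<longleftrightarrow> (\<forall>F. card F = k \<longrightarrow> even (card {K \<in> D. F \<subseteq> f K}))"

text \<open>
  Minimal non-empty cycles in the same sense.
\<close>

definition circuit_along :: "nat \<Rightarrow> ('v set \<Rightarrow> 'v set) \<Rightarrow> 'v set set \<Rightarrow> bool" where
  "circuit_along k f D \<longleftrightarrow> D \<noteq> {} \<and> cycle_along k f D \<and>
     (\<forall>D'. D' \<subset> D \<and> D' \<noteq> {} \<longrightarrow> \<not> cycle_along k f D')"

lemma card_filter_Un:
  assumes "finite D" "finite D'" "D \<inter> D' = {}"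
  shows "card {K \<in> D \<union> D'. P K} = card {K \<in> D. P K} + card {K \<in> D'. P K}"
proof -
  have "{K \<in> D \<union> D'. P K} = {K \<in> D. P K} \<union> {K \<in> D'. P K}" by blast
  moreover have "{K \<in> D. P K} \<inter> {K \<in> D'. P K} = {}" using assms(3) by blast
  moreover have "finite {K \<in> D. P K}" "finite {K \<in> D'. P K}" using assms(1,2) by simp_all
  ultimately show ?thesis by (metis card_Un_disjoint)
qed

lemma card_filter_split:
  assumes "finite D" "D' \<subseteq> D"
  shows "card {K \<in> D. P K} = card {K \<in> D'. P K} + card {K \<in> D - D'. P K}"
proof -
  have "D = D' \<union> (D - D')" using assms(2) by blast
  moreover have "finite D'" "finite (D - D')" using assms finite_subset by (blast, simp)
  ultimately show ?thesis using card_filter_Un[of D' "D - D'" P] by (metis Diff_disjoint)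
qed

lemma even_summand: "(a :: nat) = b + c \<Longrightarrow> even a \<Longrightarrow> even b \<Longrightarrow> even c"
  by simp

lemma cycle_along_Diff:
  assumes "finite D" "D' \<subseteq> D" "cycle_along k f D" "cycle_along k f D'"
  shows "cycle_along k f (D - D')"
  unfolding cycle_along_def
proof (intro allI impI)
  fix F :: "'a set" assume "card F = k"
  then have "even (card {K \<in> D. F \<subseteq> f K})" "even (card {K \<in> D'. F \<subseteq> f K})"
    using assms(3,4) unfolding cycle_along_def by blast+
  then show "even (card {K \<in> D - D'. F \<subseteq> f K})"
    by (rule even_summand[OF card_filter_split[OF assms(1,2)]])
qed

lemma cycle_along_Un:
  assumes "finite D" "finite D'" "D \<inter> D' = {}" "cycle_along k f D" "cycle_along k f D'"
  shows "cycle_along k f (D \<union> D')"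
  unfolding cycle_along_def
proof (intro allI impI)
  fix F :: "'a set" assume F: "card F = k"
  then have "even (card {K \<in> D. F \<subseteq> f K})" "even (card {K \<in> D'. F \<subseteq> f K})"
    using assms(4,5) unfolding cycle_along_def by blast+
  then show "even (card {K \<in> D \<union> D'. F \<subseteq> f K})"
    unfolding card_filter_Un[OF assms(1-3)] by (rule dvd_add)
qed

text \<open>
  A \<open>k\<close>-circuit without repeated faces, and one of its edges \<open>uv\<close>.
\<close>

locale contraction =
  fixes k :: nat and C :: "'v set set" and u v :: 'v
  assumes finite_C: "finite C" and card_face: "K \<in> C \<Longrightarrow> card K = k + 1"
    and circuit: "circuit_along k id C" and uv: "u \<noteq> v" and k2: "2 \<le> k"
    and uv_edge: "{u, v} \<in> edges C"
begin

text \<open>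
  The faces that survive the contraction of \<open>uv\<close>.
\<close>

definition A :: "'v set set" where
  "A = {K \<in> C. \<not> (u \<in> K \<and> v \<in> K)}"

text \<open>
  The contraction of \<open>v\<close> to \<open>u\<close>, on the faces in \<open>A\<close>.
\<close>

definition con :: "'v set \<Rightarrow> 'v set" where
  "con K = (if v \<in> K then insert u (K - {v}) else K)"

text \<open>
  The faces through \<open>uv\<close> that complete \<open>D\<close>: those obtained by adding \<open>v\<close> to a boundary
  face of \<open>D\<close> that contains \<open>u\<close>.  For \<open>D\<close> a cycle after contraction, \<open>D \<union> cap D\<close> is a
  cycle (\<open>cycle_with_cap\<close>).
\<close>

definition cap :: "'v set set \<Rightarrow> 'v set set" where
  "cap D = {K. card K = k + 1 \<and> u \<in> K \<and> v \<in> K \<and> odd (card {J \<in> D. K - {v} \<subseteq> J})}"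

lemma A_C: "A \<subseteq> C" and A_uv: "K \<in> A \<Longrightarrow> u \<in> K \<Longrightarrow> v \<in> K \<Longrightarrow> False"
  by (auto simp: A_def)

lemma finite_A: "finite A" using finite_C A_C finite_subset by blast

lemma finite_face: "K \<in> C \<Longrightarrow> finite K"
  using card_face by (metis card.infinite add_is_0 one_neq_zero)

lemma card_con:
  assumes "K \<in> A"
  shows "card (con K) = k + 1"
proof -
  have K: "K \<in> C" using assms A_C by blast
  show ?thesis
  proof (cases "v \<in> K")
    case True
    then have "u \<notin> K - {v}" using A_uv assms by blast
    then show ?thesis using True card_face[OF K] finite_face[OF K] by (simp add: con_def)
  qed (simp add: con_def card_face[OF K])
qed

lemma con_v: "v \<notin> con K" using uv by (simp add: con_def)

lemma con_u: "u \<in> K \<Longrightarrow> K \<in> A \<Longrightarrow> con K = K"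
  using A_uv by (auto simp: con_def)

lemma sub_con_without: "u \<notin> F \<Longrightarrow> v \<notin> F \<Longrightarrow> F \<subseteq> con K \<longleftrightarrow> F \<subseteq> K"
  by (auto simp: con_def)

lemma sub_con_with:
  assumes "K \<in> A" "u \<in> F" "v \<notin> F"
  shows "F \<subseteq> con K \<longleftrightarrow> F \<subseteq> K \<or> insert v (F - {u}) \<subseteq> K"
  using assms A_uv[of K] by (auto simp: con_def)

lemma card_sub_con:
  assumes "D \<subseteq> A" "u \<in> F" "v \<notin> F"
  shows "card {K \<in> D. F \<subseteq> con K} = card {K \<in> D. F \<subseteq> K} + card {K \<in> D. insert v (F - {u}) \<subseteq> K}"
proof -
  have "{K \<in> D. F \<subseteq> con K} = {K \<in> D. F \<subseteq> K} \<union> {K \<in> D. insert v (F - {u}) \<subseteq> K}"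
    using sub_con_with[OF _ assms(2,3)] assms(1) by blast
  moreover have "{K \<in> D. F \<subseteq> K} \<inter> {K \<in> D. insert v (F - {u}) \<subseteq> K} = {}"
    using assms A_uv by blast
  moreover have "finite D" using assms finite_A finite_subset by blast
  ultimately show ?thesis by (simp add: card_Un_disjoint)
qed

text \<open>
  After contraction the boundary cancels, so the boundary faces of \<open>D\<close> through \<open>u\<close> correspond to
  those through \<open>v\<close>.
\<close>

lemma parity_swap:
  assumes "D \<subseteq> A" "cycle_along k con D" "card F = k" "u \<in> F" "v \<notin> F"
  shows "odd (card {J \<in> D. F \<subseteq> J}) \<longleftrightarrow> odd (card {J \<in> D. insert v (F - {u}) \<subseteq> J})"
proof -
  have "even (card {K \<in> D. F \<subseteq> con K})" using assms(2,3) by (simp add: cycle_along_def)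
  then show ?thesis unfolding card_sub_con[OF assms(1,4,5)] by simp
qed

lemma odd_card_ex: "odd (card {J \<in> D. P J}) \<Longrightarrow> \<exists>J\<in>D. P J"
  by (metis (mono_tags, lifting) Collect_empty_eq card.empty even_zero)

lemma capD:
  assumes "K \<in> cap D"
  shows "card K = k + 1" "u \<in> K" "v \<in> K" "finite K" "\<exists>J\<in>D. K - {v} \<subseteq> J"
proof -
  show c: "card K = k + 1" "u \<in> K" "v \<in> K" using assms by (auto simp: cap_def)
  show "finite K" using c(1) by (metis card.infinite add_is_0 one_neq_zero)
  show "\<exists>J\<in>D. K - {v} \<subseteq> J" using assms odd_card_ex[of D] by (auto simp: cap_def)
qed

lemma cap_u:
  assumes "K \<in> cap D" "D \<subseteq> A" "cycle_along k con D"
  shows "\<exists>J\<in>D. K - {u} \<subseteq> J"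
proof -
  note K = capD[OF assms(1)]
  have "card (K - {v}) = k" using K by simp
  moreover have "insert v (K - {v} - {u}) = K - {u}" using K uv by blast
  moreover have "odd (card {J \<in> D. K - {v} \<subseteq> J})" using assms(1) by (simp add: cap_def)
  ultimately have "odd (card {J \<in> D. K - {u} \<subseteq> J})"
    using parity_swap[OF assms(2,3), of "K - {v}"] K uv by simp
  then show ?thesis by (rule odd_card_ex)
qed

lemma cap_sub:
  assumes "K \<in> cap D" "D \<subseteq> A" "cycle_along k con D"
  shows "K \<subseteq> \<Union>D"
  using capD(5)[OF assms(1)] cap_u[OF assms] uv by blast

lemma finite_cap:
  assumes "D \<subseteq> A" "cycle_along k con D"
  shows "finite (cap D)"
proof (rule finite_subset)
  show "cap D \<subseteq> Pow (\<Union>C)" using cap_sub[OF _ assms] assms(1) A_C by blast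
  show "finite (Pow (\<Union>C))" using finite_C finite_face by simp
qed

lemma cap_edges:
  assumes "K \<in> cap D" "D \<subseteq> A" "cycle_along k con D" "i \<in> K" "j \<in> K" "i \<noteq> j"
  shows "{i, j} \<in> insert {u, v} (edges D)"
proof -
  obtain J J' where J: "J \<in> D" "K - {v} \<subseteq> J" "J' \<in> D" "K - {u} \<subseteq> J'"
    using capD(5)[OF assms(1)] cap_u[OF assms(1-3)] by blast
  consider "{i, j} = {u, v}" | "i \<noteq> v" "j \<noteq> v" | "i \<noteq> u" "j \<noteq> u"
    using assms(6) uv by blast
  then show ?thesis
  proof cases
    case 2
    then have "i \<in> J" "j \<in> J" using J assms(4,5) by blast+
    then show ?thesis using J(1) assms(6) by (auto simp: edge_iff)
  next
    case 3
    then have "i \<in> J'" "j \<in> J'" using J assms(4,5) by blast+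
    then show ?thesis using J(3) assms(6) by (auto simp: edge_iff)
  qed simp
qed

text \<open>
  This is the identity "the boundary of a boundary is zero": with \<open>F' = F - {v}\<close>, every face of
  \<open>D\<close> that contains \<open>F'\<close> has exactly two further vertices.
\<close>

lemma even_cap_both:
  assumes D: "D \<subseteq> A" "cycle_along k con D" and F: "card F = k" "u \<in> F" "v \<in> F"
  shows "even (card {K \<in> cap D. F \<subseteq> K})"
proof -
  define F' where "F' = F - {v}"
  have finF: "finite F" using F(1) k2 by (metis card.infinite not_numeral_le_zero)
  have cF': "card F' = k - 1" using F finF by (simp add: F'_def)
  define W where "W = \<Union>C - F"
  define D' where "D' = {J \<in> D. F' \<subseteq> J}"
  define n where "n x = card {J \<in> D'. x \<in> J}" for x
  have finD: "finite D" using D(1) finite_A finite_subset by blast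
  have finW: "finite W" using finite_C finite_face by (auto simp: W_def)
  have nx: "n x = card {J \<in> D. insert x F - {v} \<subseteq> J}" if "x \<in> W" for x
  proof -
    have "x \<noteq> v" using that F by (auto simp: W_def)
    then show ?thesis unfolding n_def D'_def F'_def by (intro arg_cong[of _ _ card]) blast
  qed
  have "bij_betw (\<lambda>x. insert x F) {x \<in> W. odd (n x)} {K \<in> cap D. F \<subseteq> K}"
  proof (rule bij_betw_imageI)
    show "inj_on (\<lambda>x. insert x F) {x \<in> W. odd (n x)}"
      by (rule inj_onI) (auto simp: W_def)
    show "(\<lambda>x. insert x F) ` {x \<in> W. odd (n x)} = {K \<in> cap D. F \<subseteq> K}"
    proof (intro equalityI subsetI)
      fix K assume "K \<in> (\<lambda>x. insert x F) ` {x \<in> W. odd (n x)}"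
      then obtain x where x: "x \<in> W" "odd (n x)" "K = insert x F" by blast
      then show "K \<in> {K \<in> cap D. F \<subseteq> K}"
        using F finF nx[OF x(1)] by (auto simp: cap_def W_def)
    next
      fix K assume K: "K \<in> {K \<in> cap D. F \<subseteq> K}"
      then have "card (K - F) = 1"
        using capD(1,4)[of K D] F finF by (simp add: card_Diff_subset)
      then obtain x where x: "K - F = {x}" by (auto simp: card_1_singleton_iff)
      then have Kx: "K = insert x F" using K by blast
      have "K \<subseteq> \<Union>D" using K by (intro cap_sub[OF _ D]) simp
      then have "x \<in> \<Union>C" using Kx D(1) A_C by blast
      then have xW: "x \<in> W" using x by (auto simp: W_def)
      moreover have "odd (n x)" using K nx[OF xW] Kx by (simp add: cap_def)
      ultimately show "K \<in> (\<lambda>x. insert x F) ` {x \<in> W. odd (n x)}" using Kx by blast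
    qed
  qed
  then have "card {K \<in> cap D. F \<subseteq> K} = card {x \<in> W. odd (n x)}"
    by (rule bij_betw_same_card[symmetric])
  moreover have "even (card {x \<in> W. odd (n x)}) \<longleftrightarrow> even (\<Sum>x\<in>W. n x)"
    using finW by (simp add: even_sum_iff)
  moreover have "(\<Sum>x\<in>W. n x) = (\<Sum>J\<in>D'. card {x \<in> W. x \<in> J})"
    unfolding n_def using finW finD
    by (intro sum_multicount_gen) (auto simp: D'_def)
  moreover have "card {x \<in> W. x \<in> J} = 2" if "J \<in> D'" for J
  proof -
    have J: "J \<in> A" "F' \<subseteq> J" using that D(1) by (auto simp: D'_def)
    have "u \<in> J" using J F uv by (auto simp: F'_def)
    then have "v \<notin> J" using A_uv J by blast
    then have "{x \<in> W. x \<in> J} = J - F'" using J A_C by (auto simp: W_def F'_def)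
    moreover have "card (J - F') = card J - card F'"
      using J finF by (intro card_Diff_subset) (auto simp: F'_def)
    ultimately show ?thesis using card_face[of J] J A_C cF' k2 by auto
  qed
  ultimately show ?thesis by simp
qed

lemma cap_filter_single:
  assumes "x \<in> {u, v}" "card F = k" "u \<in> insert x F" "v \<in> insert x F" "x \<notin> F"
  shows "{K \<in> cap D. F \<subseteq> K} = (if insert x F \<in> cap D then {insert x F} else {})"
proof -
  have finF: "finite F" using assms(2) k2 by (metis card.infinite not_numeral_le_zero)
  have "K = insert x F" if "K \<in> cap D" "F \<subseteq> K" for K
  proof (rule sym, rule card_subset_eq)
    show "finite K" using capD that by blast
    show "insert x F \<subseteq> K" using capD(2,3)[OF that(1)] that(2) assms(1) by blast
    show "card (insert x F) = card K" using capD(1)[OF that(1)] assms(2,5) finF by simp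
  qed
  then show ?thesis by auto
qed

lemma cycle_with_cap:
  assumes D: "D \<subseteq> A" "cycle_along k con D"
  shows "cycle_along k id (D \<union> cap D)"
  unfolding cycle_along_def id_apply
proof (intro allI impI)
  fix F :: "'v set" assume F: "card F = k"
  have finF: "finite F" using F k2 by (metis card.infinite not_numeral_le_zero)
  have finD: "finite D" using D(1) finite_A finite_subset by blast
  have "D \<inter> cap D = {}" using D(1) A_uv capD(2,3) by blast
  note split = card_filter_Un[OF finD finite_cap[OF D] this, of "\<lambda>K. F \<subseteq> K"]
  consider "u \<in> F" "v \<notin> F" | "u \<notin> F" "v \<in> F" | "u \<notin> F" "v \<notin> F" | "u \<in> F" "v \<in> F" by blast
  then show "even (card {K \<in> D \<union> cap D. F \<subseteq> K})"
  proof cases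
    case 1
    have "insert v F \<in> cap D \<longleftrightarrow> odd (card {K \<in> D. F \<subseteq> K})"
      using 1 F finF by (simp add: cap_def)
    moreover have "{K \<in> cap D. F \<subseteq> K} = (if insert v F \<in> cap D then {insert v F} else {})"
      using 1 F by (intro cap_filter_single) auto
    ultimately show ?thesis unfolding split by simp
  next
    case 2
    define F' where "F' = insert u (F - {v})"
    have F': "card F' = k" "u \<in> F'" "v \<notin> F'" "insert v (F' - {u}) = F" "insert u F - {v} = F'"
      using 2 F finF uv k2 by (auto simp: F'_def card_insert_if)
    have "insert u F \<in> cap D \<longleftrightarrow> odd (card {K \<in> D. F' \<subseteq> K})"
      using 2 F finF F'(5) by (simp add: cap_def)
    also have "\<dots> \<longleftrightarrow> odd (card {K \<in> D. F \<subseteq> K})"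
      using parity_swap[OF D F'(1-3)] F'(4) by simp
    finally have "insert u F \<in> cap D \<longleftrightarrow> odd (card {K \<in> D. F \<subseteq> K})" .
    moreover have "{K \<in> cap D. F \<subseteq> K} = (if insert u F \<in> cap D then {insert u F} else {})"
      using 2 F by (intro cap_filter_single) auto
    ultimately show ?thesis unfolding split by simp
  next
    case 3
    have "\<not> F \<subseteq> K" if "K \<in> cap D" for K
    proof
      assume "F \<subseteq> K"
      then have "insert u (insert v F) \<subseteq> K" using capD(2,3)[OF that] by blast
      from card_mono[OF capD(4)[OF that] this] show False
        using 3 F finF uv capD(1)[OF that] by simp
    qed
    then have "{K \<in> cap D. F \<subseteq> K} = {}" by blast
    then have "card {K \<in> cap D. F \<subseteq> K} = 0" by (metis card.empty)
    moreover have "{K \<in> D. F \<subseteq> K} = {K \<in> D. F \<subseteq> con K}" using sub_con_without[OF 3] by simp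
    ultimately show ?thesis unfolding split using D(2) F by (simp add: cycle_along_def)
  next
    case 4
    then have "{K \<in> D. F \<subseteq> K} = {}" using D(1) A_uv by blast
    then have "card {K \<in> D. F \<subseteq> K} = 0" by (metis card.empty)
    then show ?thesis unfolding split using even_cap_both[OF D F 4] by simp
  qed
qed

lemma odd_A_iff:
  assumes "card F = k" "(u \<in> F) \<noteq> (v \<in> F)"
  shows "odd (card {J \<in> A. F \<subseteq> J}) \<longleftrightarrow> insert u (insert v F) \<in> C"
proof -
  let ?K = "insert u (insert v F)"
  have finF: "finite F" using assms(1) k2 by (metis card.infinite not_numeral_le_zero)
  have cK: "card ?K = k + 1" using assms finF by (cases "u \<in> F") (simp_all add: insert_absorb)
  have "K = ?K" if "K \<in> C - A" "F \<subseteq> K" for K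
  proof (rule sym, rule card_subset_eq)
    show "finite K" using finite_face that by blast
    show "?K \<subseteq> K" using that by (auto simp: A_def)
    show "card ?K = card K" using cK card_face that by auto
  qed
  then have "{K \<in> C - A. F \<subseteq> K} = (if ?K \<in> C then {?K} else {})"
    by (auto simp: A_def)
  then have "card {K \<in> C - A. F \<subseteq> K} = (if ?K \<in> C then 1 else 0)"
    by (simp only: card.empty card.insert split: if_split) simp
  then have "odd (card {K \<in> C - A. F \<subseteq> K}) \<longleftrightarrow> ?K \<in> C" by (simp only: split: if_split) simp
  moreover have "even (card {K \<in> C. F \<subseteq> K})"
    using circuit assms(1) by (simp add: circuit_along_def cycle_along_def)
  ultimately show ?thesis
    unfolding card_filter_split[OF finite_C A_C, of "\<lambda>K. F \<subseteq> K"] even_add by blast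
qed

lemma cap_A: "cap A = C - A"
proof (rule Set.set_eqI)
  fix K
  show "K \<in> cap A \<longleftrightarrow> K \<in> C - A"
  proof (cases "card K = k + 1 \<and> u \<in> K \<and> v \<in> K")
    case True
    then have "card (K - {v}) = k" by simp
    moreover have "insert u (insert v (K - {v})) = K" using True by blast
    ultimately have "odd (card {J \<in> A. K - {v} \<subseteq> J}) \<longleftrightarrow> K \<in> C"
      using odd_A_iff[of "K - {v}"] True uv by simp
    then show ?thesis using True by (auto simp: cap_def A_def)
  next
    case False
    then show ?thesis using card_face[of K] by (auto simp: cap_def A_def)
  qed
qed

lemma cycle_A: "cycle_along k con A"
  unfolding cycle_along_def
proof (intro allI impI)
  fix F :: "'v set" assume F: "card F = k"
  have finF: "finite F" using F k2 by (metis card.infinite not_numeral_le_zero)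
  consider "v \<in> F" | "u \<in> F" "v \<notin> F" | "u \<notin> F" "v \<notin> F" by blast
  then show "even (card {K \<in> A. F \<subseteq> con K})"
  proof cases
    case 1
    then have "{K \<in> A. F \<subseteq> con K} = {}" using con_v by blast
    then show ?thesis by (metis card.empty even_zero)
  next
    case 2
    define F' where "F' = insert v (F - {u})"
    have F': "card F' = k" "u \<notin> F'" "v \<in> F'" "insert u (insert v F') = insert u (insert v F)"
      using 2 F finF uv k2 by (auto simp: F'_def card_insert_if)
    have "odd (card {J \<in> A. F \<subseteq> J}) \<longleftrightarrow> odd (card {J \<in> A. F' \<subseteq> J})"
      using odd_A_iff[OF F] odd_A_iff[OF F'(1)] 2 F'(2-4) by simp
    then show ?thesis using card_sub_con[OF order_refl 2] unfolding F'_def by simp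
  next
    case 3
    have "\<not> F \<subseteq> K" if "K \<in> C - A" for K
    proof
      assume "F \<subseteq> K"
      then have "insert u (insert v F) \<subseteq> K" using that by (auto simp: A_def)
      from card_mono[OF _ this] show False
        using 3 F finF uv card_face[of K] finite_face[of K] that by simp
    qed
    then have "{K \<in> A. F \<subseteq> con K} = {K \<in> C. F \<subseteq> K}"
      using sub_con_without[OF 3] A_C by blast
    then show ?thesis using circuit F by (simp add: circuit_along_def cycle_along_def)
  qed
qed

lemma cap_Diff:
  assumes "D \<subseteq> A" "D' \<subseteq> D"
  shows "K \<in> cap D \<longleftrightarrow> (K \<in> cap D') \<noteq> (K \<in> cap (D - D'))"
proof -
  have "finite D" using assms(1) finite_A finite_subset by blast
  from card_filter_split[OF this assms(2), of "\<lambda>J. K - {v} \<subseteq> J"]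
  have "odd (card {J \<in> D. K - {v} \<subseteq> J}) \<longleftrightarrow>
    odd (card {J \<in> D'. K - {v} \<subseteq> J}) \<noteq> odd (card {J \<in> D - D'. K - {v} \<subseteq> J})"
    by (simp only: even_add) blast
  then show ?thesis unfolding cap_def mem_Collect_eq by blast
qed

text \<open>
  Every face of a cap lies in the cap of a minimal subfamily, since caps add up modulo \<open>2\<close>.
\<close>

lemma circuit_with_cap_face:
  assumes "D \<subseteq> A" "cycle_along k con D" "K \<in> cap D"
  shows "\<exists>B\<subseteq>D. circuit_along k con B \<and> K \<in> cap B"
proof -
  have "finite D" using assms(1) finite_A finite_subset by blast
  then show ?thesis using assms
  proof (induction D rule: finite_psubset_induct)
    case (psubset D)
    show ?case
    proof (cases "circuit_along k con D")
      case True
      then show ?thesis using psubset by blast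
    next
      case False
      have "D \<noteq> {}" using capD(5)[OF psubset.prems(3)] by blast
      then obtain D' where D': "D' \<subset> D" "D' \<noteq> {}" "cycle_along k con D'"
        using False psubset.prems(2) unfolding circuit_along_def by blast
      have c: "cycle_along k con (D - D')"
        using cycle_along_Diff[OF psubset.hyps] D' psubset.prems(2) by blast
      have "D - D' \<subset> D" using D' by blast
      have "K \<in> cap D' \<or> K \<in> cap (D - D')"
        using cap_Diff[OF psubset.prems(1), of D' K] psubset.prems(3) D' by blast
      then show ?thesis
      proof
        assume "K \<in> cap D'"
        moreover have "D' \<subseteq> A" using psubset.prems(1) D'(1) by blast
        ultimately show ?thesis using psubset.IH[OF D'(1) _ D'(3)] D'(1) by (meson psubset_imp_subset subset_trans)
      next
        assume "K \<in> cap (D - D')"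
        moreover have "D - D' \<subseteq> A" using psubset.prems(1) by blast
        ultimately show ?thesis
          using psubset.IH[OF \<open>D - D' \<subset> D\<close> _ c] by (meson Diff_subset subset_trans)
      qed
    qed
  qed
qed

lemma uv_face: "\<exists>K. K \<in> C - A"
  using uv_edge by (auto simp: edge_iff A_def)

lemma cap_subset_imp_eq:
  assumes "D \<subseteq> A" "cycle_along k con D" "D \<noteq> {}" "cap D \<subseteq> C"
  shows "D \<union> cap D = C"
proof (rule ccontr)
  assume "D \<union> cap D \<noteq> C"
  then have "D \<union> cap D \<subset> C" using assms(1,4) A_C by blast
  then show False
    using cycle_with_cap[OF assms(1,2)] circuit assms(3) unfolding circuit_along_def by blast
qed

lemma cap_nonempty:
  assumes "D \<subseteq> A" "cycle_along k con D" "D \<noteq> {}"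
  shows "cap D \<noteq> {}"
proof
  assume "cap D = {}"
  then have "D = C" using cap_subset_imp_eq[OF assms] by simp
  then show False using uv_face assms(1) by blast
qed

lemma cap_ridge:
  assumes D: "D \<subseteq> A" "cycle_along k con D" and K: "K \<in> cap D" "x \<in> K" "x \<noteq> u" "x \<noteq> v"
  shows "\<exists>c. c \<notin> K \<and> insert c (K - {x}) \<in> cap D"
proof -
  note cK = capD[OF K(1)]
  define F where "F = K - {x}"
  have F: "card F = k" "u \<in> F" "v \<in> F" using cK K by (auto simp: F_def)
  have "even (card {L \<in> cap D. F \<subseteq> L})" by (rule even_cap_both[OF D F])
  then have "card {L \<in> cap D. F \<subseteq> L} \<noteq> card {K}" by (intro notI) simp
  then have "{L \<in> cap D. F \<subseteq> L} \<noteq> {K}" by (intro notI) (simp only:)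
  moreover have "K \<in> {L \<in> cap D. F \<subseteq> L}" using K by (auto simp: F_def)
  ultimately obtain L where L: "L \<in> cap D" "F \<subseteq> L" "L \<noteq> K" by blast
  have "card (L - F) = 1"
    using capD(1,4)[OF L(1)] F L(2) cK(4) by (simp add: card_Diff_subset F_def)
  then obtain c where c: "L - F = {c}" by (auto simp: card_1_singleton_iff)
  then have "L = insert c F" using L(2) by blast
  moreover have "c \<notin> K"
  proof
    assume "c \<in> K"
    then have "c = x" using c by (auto simp: F_def)
    then show False using \<open>L = insert c F\<close> L(3) K(2) by (auto simp: F_def)
  qed
  ultimately show ?thesis using L(1) unfolding F_def by blast
qed

text \<open>
  The degenerate case is that of two faces \<open>K \<noteq> L\<close> with the same contraction, which form a
  cycle by themselves.
\<close>

lemma circuit_image: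
  assumes B: "B \<subseteq> A" "circuit_along k con B"
  shows "(\<exists>J. con ` B = {J}) \<or> circuit_along k id (con ` B)"
proof (cases "inj_on con B")
  case True
  have eq: "cycle_along k id (con ` D) = cycle_along k con D" if "D \<subseteq> B" for D
  proof -
    have "card {K \<in> con ` D. F \<subseteq> K} = card {K \<in> D. F \<subseteq> con K}" for F
    proof -
      have "{K \<in> con ` D. F \<subseteq> K} = con ` {K \<in> D. F \<subseteq> con K}" by blast
      moreover have "inj_on con {K \<in> D. F \<subseteq> con K}"
        using True that by (auto intro: inj_on_subset)
      ultimately show ?thesis by (simp add: card_image)
    qed
    then show ?thesis by (simp add: cycle_along_def)
  qed
  have "\<not> cycle_along k id D'" if "D' \<subset> con ` B" "D' \<noteq> {}" for D'
  proof -
    define D where "D = {K \<in> B. con K \<in> D'}"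
    have "con ` D = D'" using that by (auto simp: D_def)
    then have "D \<subset> B" "D \<noteq> {}" using that by (auto simp: D_def)
    then have "\<not> cycle_along k con D" using B(2) unfolding circuit_along_def by blast
    then show ?thesis using eq[of D] \<open>con ` D = D'\<close> \<open>D \<subset> B\<close> by blast
  qed
  moreover have "con ` B \<noteq> {}" "cycle_along k id (con ` B)"
    using B(2) eq[of B] by (simp_all add: circuit_along_def)
  ultimately have "circuit_along k id (con ` B)" by (simp add: circuit_along_def)
  then show ?thesis ..
next
  case False
  then obtain K L where KL: "K \<in> B" "L \<in> B" "K \<noteq> L" "con K = con L"
    unfolding inj_on_def by blast
  have "cycle_along k con {K, L}"
    unfolding cycle_along_def
  proof (intro allI impI)
    fix F
    have "{J \<in> {K, L}. F \<subseteq> con J} = (if F \<subseteq> con L then {K, L} else {})"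
      using KL(4) by auto
    then show "even (card {J \<in> {K, L}. F \<subseteq> con J})" using KL(3) by simp
  qed
  then have "\<not> {K, L} \<subset> B" using B(2) unfolding circuit_along_def by blast
  then have "B = {K, L}" using KL by blast
  then show ?thesis using KL by auto
qed

lemma edges_image:
  assumes "B \<subseteq> A" "{i, j} \<in> edges (con ` B)"
  shows "i \<noteq> v \<and> j \<noteq> v \<and>
      ({i, j} \<in> edges B \<or> i = u \<and> {v, j} \<in> edges B \<or> j = u \<and> {i, v} \<in> edges B)"
proof -
  obtain K where K: "K \<in> B" "i \<in> con K" "j \<in> con K" and ij: "i \<noteq> j"
    using assms(2) by (auto simp: edge_iff)
  have n: "i \<noteq> v" "j \<noteq> v" using K con_v by blast+
  have "(i \<in> K \<and> j \<in> K) \<or> i = u \<and> v \<in> K \<and> j \<in> K \<or> j = u \<and> i \<in> K \<and> v \<in> K"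
    using K ij by (auto simp: con_def split: if_splits)
  then show ?thesis using n ij K(1) by (auto simp: edge_iff)
qed

lemma vertices_image:
  assumes "B \<subseteq> A"
  shows "\<Union>B \<subseteq> insert v (\<Union>(con ` B))" "v \<notin> \<Union>(con ` B)" "\<Union>(con ` B) \<subseteq> \<Union>C - {v}"
proof -
  show "\<Union>B \<subseteq> insert v (\<Union>(con ` B))" by (auto simp: con_def)
  show "v \<notin> \<Union>(con ` B)" using con_v by blast
  moreover have "u \<in> \<Union>C" using uv_edge by (auto simp: edge_iff)
  then have "con K \<subseteq> \<Union>C" if "K \<in> B" for K
    using that assms A_C by (auto simp: con_def)
  ultimately show "\<Union>(con ` B) \<subseteq> \<Union>C - {v}" by blast
qed

text \<open>
  A maximal family \<open>D\<close> on which a motion \<open>m\<close> agrees with one trivial motion has its cap inside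
  \<open>C\<close>: another face \<open>K\<close> of the cap would, as \<open>cap A\<close> is contained in \<open>C\<close>, also lie in the
  cap of a circuit \<open>B\<close> disjoint from \<open>D\<close>, and two trivial motions that agree on \<open>K\<close> are
  equal.  Minimality of \<open>C\<close> then gives \<open>D \<union> cap D = C\<close>.
\<close>

lemma glue:
  fixes p :: "'v \<Rightarrow> real^'n"
  assumes dim: "CARD('n) = k + 1"
    and rigid: "\<And>B. B \<subseteq> A \<Longrightarrow> circuit_along k con B \<Longrightarrow>
      infinitesimally_rigid (\<Union>B, insert {u, v} (edges B)) p"
    and aff: "\<And>K. card K = k + 1 \<Longrightarrow> (\<And>i j. i \<in> K \<Longrightarrow> j \<in> K \<Longrightarrow> i \<noteq> j \<Longrightarrow> {i, j} \<in> edges C)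
      \<Longrightarrow> affind K p"
  shows "infinitesimally_rigid (\<Union>C, edges C) p"
  unfolding infinitesimally_rigid_def
proof (intro allI impI)
  fix m assume m: "infinitesimal_motion (\<Union>C, edges C) p m"
  have triv: "\<exists>(T :: real^'n^'n) t. transpose T = - T \<and> (\<forall>i\<in>\<Union>B. m i = T *v p i + t)"
    if "B \<subseteq> A" "circuit_along k con B" for B
  proof -
    have "insert {u, v} (edges B) \<subseteq> edges C"
      using edges_mono[OF subset_trans[OF that(1) A_C]] uv_edge by simp
    then have "infinitesimal_motion (\<Union>B, insert {u, v} (edges B)) p m"
      using m unfolding infinitesimal_motion_def snd_conv by blast
    then show ?thesis
      using rigid[OF that] unfolding infinitesimally_rigid_def trivial_motion_def fst_conv by blast
  qed
  obtain K0 where "K0 \<in> cap A" using uv_face cap_A by blast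
  then obtain B0 where B0: "B0 \<subseteq> A" "circuit_along k con B0"
    using circuit_with_cap_face[OF order_refl cycle_A] by blast
  then obtain T t where T: "transpose T = - T" "\<forall>i\<in>\<Union>B0. m i = T *v p i + t"
    using triv[OF B0] by blast
  define good where "good D \<longleftrightarrow> D \<subseteq> A \<and> cycle_along k con D \<and> D \<noteq> {} \<and>
      (\<forall>i\<in>\<Union>D. m i = T *v p i + t)" for D
  have "good B0" using B0 T(2) by (simp add: good_def circuit_along_def)
  moreover have "\<forall>D. good D \<longrightarrow> card D < Suc (card A)"
    using finite_A by (auto simp: good_def card_mono less_Suc_eq_le)
  ultimately obtain D where D: "good D" "\<And>D'. good D' \<Longrightarrow> card D' \<le> card D"
    using Lattices_Big.ex_has_greatest_nat[of good B0 card "Suc (card A)"] by blast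
  then have D': "D \<subseteq> A" "cycle_along k con D" "D \<noteq> {}" "\<And>i. i \<in> \<Union>D \<Longrightarrow> m i = T *v p i + t"
    by (auto simp: good_def)
  have "cap D \<subseteq> C"
  proof (rule ccontr)
    assume "\<not> cap D \<subseteq> C"
    then obtain K where K: "K \<in> cap D" "K \<notin> C" by blast
    then have "K \<in> cap (A - D)" using cap_Diff[OF order_refl D'(1), of K] cap_A by blast
    moreover have cAD: "cycle_along k con (A - D)"
      using cycle_along_Diff[OF finite_A D'(1) cycle_A D'(2)] .
    ultimately obtain B where B: "B \<subseteq> A - D" "circuit_along k con B" "K \<in> cap B"
      using circuit_with_cap_face[of "A - D" K] by blast
    have BA: "B \<subseteq> A" and Bc: "cycle_along k con B" "B \<noteq> {}"
      using B by (auto simp: circuit_along_def)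
    obtain T' t' where T': "transpose T' = - T'" "\<forall>i\<in>\<Union>B. m i = T' *v p i + t'"
      using triv[OF BA B(2)] by blast
    have KD: "K \<subseteq> \<Union>D" by (rule cap_sub[OF K(1) D'(1,2)])
    have KB: "K \<subseteq> \<Union>B" by (rule cap_sub[OF B(3) BA Bc(1)])
    note cK = capD[OF K(1)]
    have "affind K p"
    proof (rule aff[OF cK(1)])
      fix i j assume "i \<in> K" "j \<in> K" "i \<noteq> j"
      from cap_edges[OF K(1) D'(1,2) this] show "{i, j} \<in> edges C"
        using uv_edge edges_mono[OF subset_trans[OF D'(1) A_C]] by (metis insertE subsetD)
    qed
    moreover have "transpose (T' - T) = transpose T' - transpose T"
      by (simp add: transpose_def vec_eq_iff)
    then have "transpose (T' - T) = - (T' - T)" by (simp add: T(1) T'(1))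
    moreover have "(T' - T) *v p i + (t' - t) = 0" if "i \<in> K" for i
    proof -
      have "m i = T *v p i + t" "m i = T' *v p i + t'" using that KD KB D'(4) T'(2) by blast+
      then have "(T' *v p i + t') - (T *v p i + t) = 0" by simp
      then show ?thesis by (simp add: matrix_vector_mult_diff_rdistrib add_diff_add)
    qed
    moreover have "card K = CARD('n)" using cK(1) dim by simp
    ultimately have eq: "(T' - T) *v x = 0" "t' - t = 0" for x
      using trivial_motion_vanishing[of K p "T' - T" "t' - t"] cK(4) by blast+
    have "m i = T *v p i + t" if "i \<in> \<Union>B" for i
    proof -
      have "m i = T' *v p i + t'" using T'(2) that by blast
      moreover have "T' *v p i = T *v p i" "t' = t"
        using eq(1)[of "p i"] eq(2) by (simp_all add: matrix_vector_mult_diff_rdistrib)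
      ultimately show ?thesis by simp
    qed
    moreover have "cycle_along k con (D \<union> B)"
      using cycle_along_Un[of D B] D' B Bc finite_A finite_subset BA by blast
    moreover have "D \<union> B \<subseteq> A" "D \<union> B \<noteq> {}" using D'(1,3) BA by blast+
    ultimately have "good (D \<union> B)" unfolding good_def using D'(4) by blast
    then have "card (D \<union> B) \<le> card D" by (rule D(2))
    moreover have "card (D \<union> B) = card D + card B"
      using B(1) D'(1) BA finite_A by (intro card_Un_disjoint) (auto intro: finite_subset)
    moreover have "card B > 0" using Bc(2) BA finite_A finite_subset by (metis card_gt_0_iff)
    ultimately show False by simp
  qed
  then have C: "D \<union> cap D = C" by (rule cap_subset_imp_eq[OF D'(1-3)])
  have "\<Union>C \<subseteq> \<Union>D" using C cap_sub[OF _ D'(1,2)] by blast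
  then have "\<forall>i\<in>\<Union>C. m i = T *v p i + t" using D'(4) by blast
  then show "trivial_motion (\<Union>C, edges C) p m"
    unfolding trivial_motion_def fst_conv using T(1) by blast
qed

end

section \<open>Rigidity of circuits with at most one adjacent pair\<close>

context symmetric_pairing
begin

text \<open>
  At most one pair is joined by an edge.
\<close>

definition one_adjacent_pair :: "'v set set \<Rightarrow> bool" where
  "one_adjacent_pair C \<longleftrightarrow> (\<forall>x\<in>X. \<forall>y\<in>X. {x, star x} \<in> edges C \<longrightarrow> {y, star y} \<in> edges C \<longrightarrow>
     y = x \<or> y = star x)"

lemma one_adjacent_pairD:
  "one_adjacent_pair C \<Longrightarrow> x \<in> X \<Longrightarrow> y \<in> X \<Longrightarrow> {x, star x} \<in> edges C \<Longrightarrow>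
    {y, star y} \<in> edges C \<Longrightarrow> y = x \<or> y = star x"
  unfolding one_adjacent_pair_def by blast

lemma few_pairs_clique:
  assumes "one_adjacent_pair C" "\<And>i j. i \<in> K \<Longrightarrow> j \<in> K \<Longrightarrow> i \<noteq> j \<Longrightarrow> {i, j} \<in> edges C"
  shows "few_pairs K"
  unfolding few_pairs_def
proof (intro ballI impI)
  fix x y assume xy: "x \<in> X \<inter> K" "y \<in> X \<inter> K" "star x \<in> K" "star y \<in> K"
  have "star x \<noteq> x" "star y \<noteq> y" using star_neq xy by blast+
  then have "{x, star x} \<in> edges C" "{y, star y} \<in> edges C"
    using xy by (auto intro!: assms(2))
  then show "y = x \<or> y = star x" using one_adjacent_pairD[OF assms(1)] xy by blast
qed

lemma simplex_rigid:
  assumes "card J = k + 1" "few_pairs J"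
  shows "\<exists>p. symmetric p \<and> infinitesimally_rigid (\<Union>{J}, edges {J}) p \<and> affind J p"
proof -
  have finJ: "finite J" using assms(1) by (metis card.infinite add_is_0 one_neq_zero)
  have "card J \<le> k + 1" using assms(1) by simp
  from affind_feasible[OF finJ this assms(2)]
  obtain p where p: "symmetric p" "affind J p" by blast
  have "infinitesimally_rigid (\<Union>{J}, edges {J}) p \<longleftrightarrow>
    (\<forall>m. infinitesimal_motion (\<Union>{J}, edges {J}) p m \<and> (\<forall>i\<in>J. m i = 0) \<longrightarrow>
      (\<forall>i\<in>fst (\<Union>{J}, edges {J}). m i = 0))"
    using finJ assms(1) dim p(2) by (intro rigid_iff_pinned) (simp_all add: edge_iff)
  then have "infinitesimally_rigid (\<Union>{J}, edges {J}) p" by simp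
  with p show ?thesis by blast
qed

text \<open>
  Some edge \<open>uv\<close> with \<open>v\<close> outside \<open>X\<close> can be contracted without creating a second adjacent
  pair.  Suppose not.  A face with a vertex \<open>w\<close> outside \<open>X\<close> would have its other \<open>k\<close>
  vertices in \<open>X\<close>, no two paired and none in the adjacent pair, which needs \<open>2 * k + 2\<close>
  elements of \<open>X\<close>.  If all vertices lie in \<open>X\<close>, every face contains a pair, hence the
  same pair \<open>a\<close>, \<open>star a\<close>, and a face minus \<open>a\<close> lies in only one face.
\<close>

lemma contractible_edge:
  assumes finC: "finite C" and cardC: "\<And>K. K \<in> C \<Longrightarrow> card K = k + 1"
    and cyc: "cycle_along k id C" and "C \<noteq> {}" and one: "one_adjacent_pair C"
  shows "\<exists>u v. {u, v} \<in> edges C \<and> v \<notin> X \<and> (u \<in> X \<longrightarrow> {v, star u} \<notin> edges C \<or>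
    {u, star u} \<in> edges C \<or> (\<forall>x\<in>X. {x, star x} \<notin> edges C))"
proof (rule ccontr)
  assume "\<not> ?thesis"
  then have bad: "u \<in> X" "{v, star u} \<in> edges C" "{u, star u} \<notin> edges C"
      "\<exists>x\<in>X. {x, star x} \<in> edges C"
    if "{u, v} \<in> edges C" "v \<notin> X" for u v
    using that by blast+
  have finK: "finite K" if "K \<in> C" for K
    using cardC[OF that] by (metis card.infinite add_is_0 one_neq_zero)
  \<comment> \<open>A set without pairs takes up twice its size in \<open>X\<close>.\<close>
  have double: "2 * card M \<le> card Y"
    if "M \<subseteq> Y" "star ` M \<subseteq> Y" "Y \<subseteq> X" "M \<inter> star ` M = {}" for M Y
  proof -
    have "finite Y" using that(3) finite_X finite_subset by blast
    then have fin: "finite M" using that(1) finite_subset by blast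
    have "inj_on star M"
      using that star_star by (intro inj_onI) (metis subsetD)
    then have "card (M \<union> star ` M) = 2 * card M"
      using fin that(4) by (simp add: card_Un_disjoint card_image)
    moreover have "card (M \<union> star ` M) \<le> card Y"
      using that \<open>finite Y\<close> by (intro card_mono) auto
    ultimately show ?thesis by simp
  qed
  show False
  proof (cases "\<Union>C \<subseteq> X")
    case False
    then obtain w K where w: "K \<in> C" "w \<in> K" "w \<notin> X" by blast
    have e: "{x, w} \<in> edges C" if "x \<in> K - {w}" for x
      using that w by (auto simp: edge_iff)
    have "card (K - {w}) = k" using cardC[OF w(1)] w(2) by simp
    then have "K - {w} \<noteq> {}" using k2 by (metis card.empty not_numeral_le_zero)
    then obtain a where a: "a \<in> X" "{a, star a} \<in> edges C" using bad(4)[OF e] w(3) by blast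
    have KX: "x \<in> X" "{x, star x} \<notin> edges C" if "x \<in> K - {w}" for x
      using bad(1,3)[OF e[OF that] w(3)] .
    have a': "{star a, star (star a)} \<in> edges C" using a star_star by (simp add: insert_commute)
    have "2 * card (K - {w}) \<le> card (X - {a, star a})"
    proof (rule double)
      show "K - {w} \<subseteq> X - {a, star a}" using KX a(2) a' by blast
      show "star ` (K - {w}) \<subseteq> X - {a, star a}"
      proof
        fix y assume "y \<in> star ` (K - {w})"
        then obtain x where x: "x \<in> K - {w}" "y = star x" by blast
        have "star y = x" using x KX star_star by blast
        moreover have "x \<noteq> a" "x \<noteq> star a" using KX[OF x(1)] a(2) a' by blast+
        ultimately have "y \<noteq> star a" "y \<noteq> a" using star_star a(1) by blast+
        then show "y \<in> X - {a, star a}" using x KX star_in by blast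
      qed
      show "X - {a, star a} \<subseteq> X" by blast
      show "(K - {w}) \<inter> star ` (K - {w}) = {}"
      proof (rule ccontr)
        assume "(K - {w}) \<inter> star ` (K - {w}) \<noteq> {}"
        then obtain x where x: "x \<in> K - {w}" "star x \<in> K - {w}" by blast
        then have "{x, star x} \<in> edges C"
          using w(1) star_neq[of x] KX(1)[OF x(1)] by (auto simp: edge_iff)
        then show False using KX(2)[OF x(1)] by blast
      qed
    qed
    moreover have "card (X - {a, star a}) = card X - 2"
      using a(1) star_in[OF a(1)] star_neq[OF a(1)] finite_X by (simp add: card_Diff_subset)
    ultimately show False using \<open>card (K - {w}) = k\<close> card_X k2 by simp
  next
    case True
    have pair: "\<exists>x. x \<in> X \<and> x \<in> K \<and> star x \<in> K" if "K \<in> C" for K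
    proof (rule ccontr)
      assume no: "\<nexists>x. x \<in> X \<and> x \<in> K \<and> star x \<in> K"
      have "K \<subseteq> X" using True that by blast
      moreover have "star ` K \<subseteq> X" using \<open>K \<subseteq> X\<close> star_in by blast
      moreover have "K \<inter> star ` K = {}" using no \<open>K \<subseteq> X\<close> by blast
      ultimately have "2 * card K \<le> card X" by (intro double) simp_all
      then show False using cardC[OF that] card_X by simp
    qed
    have adj: "{x, star x} \<in> edges C" if "x \<in> X" "x \<in> K" "star x \<in> K" "K \<in> C" for x K
      using that star_neq[of x] by (auto simp: edge_iff)
    obtain K where K: "K \<in> C" using assms(4) by blast
    obtain a where a: "a \<in> X" "a \<in> K" "star a \<in> K" using pair[OF K] by blast
    have all: "a \<in> L" if L: "L \<in> C" for L
    proof -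
      obtain b where b: "b \<in> X" "b \<in> L" "star b \<in> L" using pair[OF L] by blast
      have "b = a \<or> b = star a"
        using one_adjacent_pairD[OF one a(1) b(1) adj[OF a K] adj[OF b L]] .
      then show ?thesis using b star_star[OF a(1)] by auto
    qed
    have "{L \<in> C. K - {a} \<subseteq> L} = {K}"
    proof (intro equalityI subsetI)
      fix L assume "L \<in> {L \<in> C. K - {a} \<subseteq> L}"
      then have L: "L \<in> C" "K \<subseteq> L" using all by auto
      then have "K = L" using card_subset_eq[OF finK[OF L(1)] L(2)] cardC K by simp
      then show "L \<in> {K}" by simp
    qed (use K in auto)
    then have "card {L \<in> C. K - {a} \<subseteq> id L} = 1" by simp
    moreover have "card (K - {a}) = k" using cardC[OF K] a(2) by simp
    ultimately show False using cyc unfolding cycle_along_def by (metis odd_one)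
  qed
qed

lemma one_adjacent_pair_contraction:
  assumes Q: "contraction k C u v" and B: "B \<subseteq> contraction.A C u v" and "v \<notin> X"
    and one: "one_adjacent_pair C"
    and good: "u \<in> X \<longrightarrow> {v, star u} \<notin> edges C \<or> {u, star u} \<in> edges C \<or>
      (\<forall>x\<in>X. {x, star x} \<notin> edges C)"
  shows "one_adjacent_pair (contraction.con u v ` B)"
proof -
  interpret Q: contraction k C u v by (rule Q)
  have BC: "e \<in> edges C" if "e \<in> edges B" for e
    using that edges_mono[OF subset_trans[OF B Q.A_C]] by blast
  have cases: "{x, star x} \<in> edges C \<or>
      u \<in> X \<and> {v, star u} \<in> edges C \<and> (x = u \<or> x = star u)"
    if x: "x \<in> X" "{x, star x} \<in> edges (Q.con ` B)" for x
  proof -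
    from Q.edges_image[OF B x(2)] consider "{x, star x} \<in> edges B"
      | "x = u" "{v, star x} \<in> edges B" | "star x = u" "{x, v} \<in> edges B" by blast
    then show ?thesis
    proof cases
      case 3
      then have "x = star u" "u \<in> X" using star_star star_in x(1) by auto
      then show ?thesis using BC[OF 3(2)] by (simp add: insert_commute)
    qed (use BC x in blast)+
  qed
  show ?thesis
    unfolding one_adjacent_pair_def
  proof (intro ballI impI)
    fix x y assume xy: "x \<in> X" "y \<in> X" "{x, star x} \<in> edges (Q.con ` B)"
      "{y, star y} \<in> edges (Q.con ` B)"
    show "y = x \<or> y = star x"
    proof (cases "u \<in> X \<and> (\<forall>x\<in>X. {x, star x} \<notin> edges C)")
      case True
      then have "x = u \<or> x = star u" "y = u \<or> y = star u" using cases xy by blast+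
      then show ?thesis using star_star True by auto
    next
      case False
      have "{z, star z} \<in> edges C" if "z \<in> X" "{z, star z} \<in> edges (Q.con ` B)" for z
      proof (rule ccontr)
        assume z: "{z, star z} \<notin> edges C"
        then have z': "u \<in> X" "{v, star u} \<in> edges C" "z = u \<or> z = star u"
          using cases[OF that] by blast+
        then have "{u, star u} \<in> edges C" using good False by blast
        then have "{z, star z} \<in> edges C" using z'(3) star_star[OF z'(1)] by (auto simp: insert_commute)
        with z show False by contradiction
      qed
      then show ?thesis using one_adjacent_pairD[OF one xy(1,2)] xy by blast
    qed
  qed
qed

text \<open>
  The cap of \<open>B\<close> contains two faces with a common ridge, and these can be chosen such that \<open>u\<close>
  and the \<open>k\<close> common neighbours of \<open>u\<close> and \<open>v\<close> that they provide contain at most one pair.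
\<close>

lemma split_ridge:
  assumes Q: "contraction k C u v" and B: "B \<subseteq> contraction.A C u v"
    "cycle_along k (contraction.con u v) B" "B \<noteq> {}"
    and "v \<notin> X" and one: "one_adjacent_pair C"
  shows "\<exists>K x c. K \<in> contraction.cap k u v B \<and> x \<in> K - {u, v} \<and> c \<notin> K \<and>
    insert c (K - {x}) \<in> contraction.cap k u v B \<and> few_pairs (insert c (K - {v}))"
proof -
  interpret Q: contraction k C u v by (rule Q)
  have adj: "{i, j} \<in> edges C" if "K \<in> Q.cap B" "i \<in> K" "j \<in> K" "i \<noteq> j" for K i j
    using Q.cap_edges[OF that(1) B(1,2) that(2-4)] Q.uv_edge
      edges_mono[OF subset_trans[OF B(1) Q.A_C]] by (metis insertE subsetD)
  obtain K where K: "K \<in> Q.cap B" using Q.cap_nonempty[OF B] by blast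
  note cK = Q.capD[OF K]
  show ?thesis
  proof (cases "\<exists>a\<in>X. a \<in> K \<and> star a \<in> K")
    case False
    have "card (K - {u, v}) = k - 1"
      using cK Q.uv by (simp add: card_Diff_subset)
    then have "K - {u, v} \<noteq> {}" using k2 by (intro notI) simp
    then obtain x where x: "x \<in> K - {u, v}" by blast
    then obtain c where c: "c \<notin> K" "insert c (K - {x}) \<in> Q.cap B"
      using Q.cap_ridge[OF B(1,2) K, of x] by blast
    have "few_pairs (insert c (K - {v}))"
      unfolding few_pairs_def
    proof (intro ballI impI)
      fix y z assume yz: "y \<in> X \<inter> insert c (K - {v})" "z \<in> X \<inter> insert c (K - {v})"
        "star y \<in> insert c (K - {v})" "star z \<in> insert c (K - {v})"
      then have "y = c \<or> star y = c" "z = c \<or> star z = c" using False by blast+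
      then show "z = y \<or> z = star y" using star_star yz by (metis IntD1)
    qed
    then show ?thesis using K x c by blast
  next
    case True
    then obtain a where a: "a \<in> X" "a \<in> K" "star a \<in> K" by blast
    \<comment> \<open>If the face \<open>K\<close> contains a pair, it is left through a member of this pair, so that the new vertex \<open>c\<close> cannot bring in a second one.\<close>
    obtain x where x: "x \<in> X" "x \<in> K" "star x \<in> K" "x \<noteq> u"
    proof (cases "a = u")
      case True
      then show ?thesis using that[of "star a"] a star_in star_star star_neq by metis
    qed (use a that in blast)
    have xv: "x \<noteq> v" using x(1) assms(5) by blast
    obtain c where c: "c \<notin> K" "insert c (K - {x}) \<in> Q.cap B"
      using Q.cap_ridge[OF B(1,2) K, of x] x xv by blast
    have ax: "{x, star x} \<in> edges C" using adj[OF K x(2,3)] star_neq[OF x(1)] by metis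
    have only: "y = x \<or> y = star x"
      if y: "y \<in> X" "y \<in> insert c (K - {v})" "star y \<in> insert c (K - {v})" for y
    proof (rule ccontr)
      assume n: "\<not> (y = x \<or> y = star x)"
      then have "star y \<noteq> x" using star_star[OF y(1)] by metis
      have "y \<noteq> star y" using star_neq[OF y(1)] by metis
      have "y \<in> insert c (K - {x})" "star y \<in> insert c (K - {x})"
        using y n \<open>star y \<noteq> x\<close> by blast+
      then have "{y, star y} \<in> edges C" using adj[OF c(2)] \<open>y \<noteq> star y\<close> by blast
      then show False using one_adjacent_pairD[OF one x(1) y(1) ax] n by blast
    qed
    have "few_pairs (insert c (K - {v}))"
      unfolding few_pairs_def
    proof (intro ballI impI)
      fix y z assume yz: "y \<in> X \<inter> insert c (K - {v})" "z \<in> X \<inter> insert c (K - {v})"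
        "star y \<in> insert c (K - {v})" "star z \<in> insert c (K - {v})"
      then have "y = x \<or> y = star x" "z = x \<or> z = star x" using only by blast+
      then show "z = y \<or> z = star y" using star_star[OF x(1)] by metis
    qed
    then show ?thesis using K x xv c by blast
  qed
qed

text \<open>
  From a rigid placement of the contraction of \<open>B\<close> to generic rigidity of \<open>B\<close> with the edge
  \<open>uv\<close>.  Motions are pinned at a face \<open>J\<close> that contains \<open>u\<close> and so is unchanged by the
  contraction.
\<close>

lemma split_rigid:
  assumes Q: "contraction k C u v" and B: "B \<subseteq> contraction.A C u v"
    "cycle_along k (contraction.con u v) B" "B \<noteq> {}"
    and vX: "v \<notin> X" and one: "one_adjacent_pair C"
    and q: "symmetric q"
      "infinitesimally_rigid (\<Union>(contraction.con u v ` B), edges (contraction.con u v ` B)) q"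
      "\<forall>K\<in>contraction.con u v ` B. affind K q"
  shows "\<exists>K. generic (\<lambda>p. affind K p \<and> infinitesimally_rigid (\<Union>B, insert {u, v} (edges B)) p)"
proof -
  interpret Q: contraction k C u v by (rule Q)
  let ?V' = "\<Union>(Q.con ` B)" and ?E' = "edges (Q.con ` B)"
  have finU: "finite (\<Union>C)" using Q.finite_C Q.finite_face by simp
  have finV: "finite (\<Union>B)" by (rule finite_subset[OF _ finU]) (use B(1) Q.A_C in blast)
  have finV': "finite ?V'"
    by (rule finite_subset[OF Q.vertices_image(3)[OF B(1)]]) (simp add: finU)
  have edge_in: "i \<in> \<Union>D \<and> j \<in> \<Union>D \<and> i \<noteq> j" if "{i, j} \<in> edges D" for i j and D :: "'v set set"
    using that by (auto simp: edge_iff)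
  obtain K x c where K: "K \<in> Q.cap B" "x \<in> K - {u, v}" "c \<notin> K"
    "insert c (K - {x}) \<in> Q.cap B" "few_pairs (insert c (K - {v}))"
    using split_ridge[OF Q B vX one] by blast
  note cK = Q.capD[OF K(1)] and cL = Q.capD[OF K(4)]
  define N where "N = insert c (K - {u, v})"
  have uN: "insert u N = insert c (K - {v})" using cK(2) Q.uv by (auto simp: N_def)
  have "card (insert c (K - {v})) = k + 1" using cK K(3) by simp
  moreover have "u \<notin> N" "finite N" using K(3) cK by (auto simp: N_def)
  ultimately have cN: "card N + 1 = CARD('n)" using uN dim by (metis Suc_eq_plus1 card_insert_disjoint)
  obtain J where J: "J \<in> B" "K - {v} \<subseteq> J" using cK(5) by blast
  have uJ: "u \<in> J" using J(2) cK(2) Q.uv by blast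
  have vJ: "v \<notin> J" using Q.A_uv uJ J(1) B(1) by blast
  have J': "J \<in> Q.con ` B" using Q.con_u[OF uJ] J(1) B(1) by (metis image_eqI subsetD)
  have cJ: "card J = k + 1" using Q.card_face J(1) B(1) Q.A_C by blast
  have finJ: "finite J" using cJ by (metis card.infinite add_is_0 one_neq_zero)
  have "generic (\<lambda>p. affind J p \<and> infinitesimally_rigid (?V', ?E') p)"
  proof (rule generic_rigid[OF finV' _ _ cJ])
    show "i \<in> ?V' \<and> j \<in> ?V'" if "{i, j} \<in> ?E'" for i j using edge_in[OF that] by blast
    show "J \<subseteq> ?V'" using J' by blast
    show "{i, j} \<in> ?E'" if "i \<in> J" "j \<in> J" "i \<noteq> j" for i j
      using that J' by (auto simp: edge_iff)
  qed (use q J' in blast)+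
  moreover have "generic (affind (insert u N))"
    unfolding uN using cK K(3,5) by (intro generic_affind) simp_all
  ultimately have "generic (\<lambda>p. (affind J p \<and> infinitesimally_rigid (?V', ?E') p) \<and> affind (insert u N) p)"
    by (rule generic_conj)
  then obtain p where p: "symmetric p" "affind J p" "infinitesimally_rigid (?V', ?E') p"
    "affind (insert u N) p"
    unfolding generic_def by blast
  have pin: "pinned (?V', ?E') J p"
    using p(3) rigid_iff_pinned[of J "(?V', ?E')" p] J' finJ cJ dim p(2)
    unfolding pinned_def fst_conv snd_conv by (auto simp: edge_iff)
  have nb: "{u, y} \<in> edges B \<and> {v, y} \<in> edges B" if "y \<in> N" for y
  proof -
    have "\<exists>L\<in>Q.cap B. y \<in> L" "y \<noteq> u" "y \<noteq> v"
      using that K(1,3,4) cK(2,3) unfolding N_def by blast+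
    then obtain L where L: "L \<in> Q.cap B" "y \<in> L" by blast
    have "{u, y} \<in> insert {u, v} (edges B)" "{v, y} \<in> insert {u, v} (edges B)"
      using Q.cap_edges[OF L(1) B(1,2) _ L(2)] Q.capD(2,3)[OF L(1)] \<open>y \<noteq> u\<close> \<open>y \<noteq> v\<close> by metis+
    then show ?thesis using \<open>y \<noteq> u\<close> \<open>y \<noteq> v\<close> by (simp add: doubleton_eq_iff)
  qed
  have KB: "K \<subseteq> \<Union>B" by (rule Q.cap_sub[OF K(1) B(1,2)])
  have "\<exists>w. pinned (\<Union>B, insert {u, v} (edges B)) J (p(v := w))"
  proof (rule vertex_split[where V' = ?V' and E' = ?E' and N = N])
    show "{u, v} \<notin> edges B" using Q.A_uv B(1) by (auto simp: edge_iff)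
    show "u \<in> ?V'" using uJ J' by blast
    show "u \<in> \<Union>B" "v \<in> \<Union>B" using KB cK by blast+
    show "\<Union>B \<subseteq> insert v ?V'" by (rule Q.vertices_image(1)[OF B(1)])
    show "i \<noteq> v \<and> j \<noteq> v \<and> ({i, j} \<in> edges B \<or> i = u \<and> {v, j} \<in> edges B \<or> j = u \<and> {i, v} \<in> edges B)"
      if "{i, j} \<in> ?E'" for i j
      by (rule Q.edges_image[OF B(1) that])
    show "i \<in> \<Union>B \<and> j \<in> \<Union>B \<and> i \<noteq> j" if "{i, j} \<in> edges B" for i j
      by (rule edge_in[OF that])
  qed (fact finV Q.uv vJ pin \<open>finite N\<close> \<open>u \<notin> N\<close> cN p(4) nb)+
  then obtain w where w: "pinned (\<Union>B, insert {u, v} (edges B)) J (p(v := w))" by blast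
  have clique: "{i, j} \<in> insert {u, v} (edges B)" if "i \<in> J" "j \<in> J" "i \<noteq> j" for i j
    using that J(1) by (auto simp: edge_iff)
  have aff: "affind J (p(v := w))" using p(2) affind_cong[of J "p(v := w)" p] vJ by (metis fun_upd_other)
  have "infinitesimally_rigid (\<Union>B, insert {u, v} (edges B)) (p(v := w))"
    using w rigid_iff_pinned[of J "(\<Union>B, insert {u, v} (edges B))" "p(v := w)"] J(1) finJ cJ dim aff clique
    unfolding pinned_def fst_conv snd_conv by (metis Union_upper)
  moreover have "symmetric (p(v := w))"
    unfolding symmetric_def
  proof
    fix y assume y: "y \<in> X"
    then have "y \<noteq> v" "star y \<noteq> v" using vX star_in by blast+
    then show "(p(v := w)) (star y) = g *v (p(v := w)) y" using p(1) y by (simp add: symmetric_def)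
  qed
  moreover have "i \<in> \<Union>B \<and> j \<in> \<Union>B" if "{i, j} \<in> insert {u, v} (edges B)" for i j
    using that edge_in[of i j B] KB cK(2,3) by (auto simp: doubleton_eq_iff)
  ultimately show ?thesis
    using generic_rigid[OF finV _ _ cJ clique _ aff] J(1) by (intro exI[of _ J]) blast
qed

theorem circuit_rigid:
  assumes "finite C" "\<And>K. K \<in> C \<Longrightarrow> card K = k + 1" "circuit_along k id C" "one_adjacent_pair C"
  shows "\<exists>p. symmetric p \<and> infinitesimally_rigid (\<Union>C, edges C) p \<and> (\<forall>K\<in>C. affind K p)"
  using assms
proof (induction "card (\<Union>C)" arbitrary: C rule: less_induct)
  case less
  note one = less.prems(4)
  have "C \<noteq> {}" "cycle_along k id C" using less.prems(3) by (auto simp: circuit_along_def)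
  then obtain u v where uv: "{u, v} \<in> edges C" "v \<notin> X"
    "u \<in> X \<longrightarrow> {v, star u} \<notin> edges C \<or> {u, star u} \<in> edges C \<or> (\<forall>x\<in>X. {x, star x} \<notin> edges C)"
    using contractible_edge[OF less.prems(1,2) _ _ one] by blast
  have Q: "contraction k C u v"
    using less.prems uv(1) k2 by unfold_locales (auto simp: edge_iff)
  interpret Q: contraction k C u v by (rule Q)
  have finU: "finite (\<Union>C)" using Q.finite_C Q.finite_face by simp
  define BB where "BB = {B. B \<subseteq> Q.A \<and> circuit_along k Q.con B}"
  have "\<exists>K. generic (\<lambda>p. affind K p \<and> infinitesimally_rigid (\<Union>B, insert {u, v} (edges B)) p)"
    if "B \<in> BB" for B
  proof -
    have B: "B \<subseteq> Q.A" "circuit_along k Q.con B" using that by (auto simp: BB_def)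
    have B': "cycle_along k Q.con B" "B \<noteq> {}" using B(2) by (auto simp: circuit_along_def)
    have one': "one_adjacent_pair (Q.con ` B)"
      by (rule one_adjacent_pair_contraction[OF Q B(1) uv(2) one uv(3)])
    have cB: "card K = k + 1" if "K \<in> Q.con ` B" for K using that Q.card_con B(1) by blast
    have "\<exists>q. symmetric q \<and> infinitesimally_rigid (\<Union>(Q.con ` B), edges (Q.con ` B)) q \<and>
        (\<forall>K\<in>Q.con ` B. affind K q)"
      using Q.circuit_image[OF B]
    proof
      assume "\<exists>J. Q.con ` B = {J}"
      then obtain J where J: "Q.con ` B = {J}" by blast
      have "few_pairs J"
      proof (rule few_pairs_clique)
        show "one_adjacent_pair {J}" using one' J by metis
        show "{i, j} \<in> edges {J}" if "i \<in> J" "j \<in> J" "i \<noteq> j" for i j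
          using that by (simp add: edge_iff)
      qed
      moreover have "card J = k + 1" by (rule cB) (simp add: J)
      ultimately obtain q where "symmetric q" "infinitesimally_rigid (\<Union>{J}, edges {J}) q"
        "affind J q"
        using simplex_rigid by blast
      then show ?thesis unfolding J by blast
    next
      assume c: "circuit_along k id (Q.con ` B)"
      have "v \<in> \<Union>C" using uv(1) by (auto simp: edge_iff)
      then have "\<Union>(Q.con ` B) \<subset> \<Union>C" using Q.vertices_image(3)[OF B(1)] by blast
      then have "card (\<Union>(Q.con ` B)) < card (\<Union>C)" by (rule psubset_card_mono[OF finU])
      moreover have "finite (Q.con ` B)" using B(1) Q.finite_A finite_subset by blast
      ultimately show ?thesis using less.hyps c cB one' by blast
    qed
    then show ?thesis using split_rigid[OF Q B(1) B' uv(2) one] by blast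
  qed
  then have "\<forall>B\<in>BB. \<exists>K. generic (\<lambda>p. affind K p \<and> infinitesimally_rigid (\<Union>B, insert {u, v} (edges B)) p)"
    by blast
  from bchoice[OF this] obtain K0 where K0:
    "\<And>B. B \<in> BB \<Longrightarrow> generic (\<lambda>p. affind (K0 B) p \<and> infinitesimally_rigid (\<Union>B, insert {u, v} (edges B)) p)"
    by blast
  \<comment> \<open>All cliques on \<open>k + 1\<close> vertices, which include the faces of \<open>C\<close> and those of all caps.\<close>
  define KK where "KK = {K. K \<subseteq> \<Union>C \<and> card K = k + 1 \<and>
    (\<forall>i\<in>K. \<forall>j\<in>K. i \<noteq> j \<longrightarrow> {i, j} \<in> edges C)}"
  have finBB: "finite BB" unfolding BB_def using Q.finite_A by (auto intro: finite_subset[of _ "Pow Q.A"])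
  have finKK: "finite KK" unfolding KK_def using finU by (auto intro: finite_subset[of _ "Pow (\<Union>C)"])
  have KKg: "generic (affind K)" if "K \<in> KK" for K
  proof (rule generic_affind)
    show "finite K" using that finU finite_subset unfolding KK_def by blast
    show "card K \<le> k + 1" using that by (simp add: KK_def)
    show "few_pairs K" using that by (intro few_pairs_clique[OF one]) (simp add: KK_def)
  qed
  from generic_conj[OF generic_Ball[OF finBB K0] generic_Ball[OF finKK KKg]]
  have "generic (\<lambda>p. (\<forall>B\<in>BB. affind (K0 B) p \<and>
      infinitesimally_rigid (\<Union>B, insert {u, v} (edges B)) p) \<and> (\<forall>K\<in>KK. affind K p))" .
  then obtain p where p: "symmetric p"
    "\<And>B. B \<in> BB \<Longrightarrow> infinitesimally_rigid (\<Union>B, insert {u, v} (edges B)) p"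
    "\<And>K. K \<in> KK \<Longrightarrow> affind K p"
    unfolding generic_def by blast
  have "infinitesimally_rigid (\<Union>C, edges C) p"
  proof (rule Q.glue[OF dim])
    show "infinitesimally_rigid (\<Union>B, insert {u, v} (edges B)) p"
      if "B \<subseteq> Q.A" "circuit_along k Q.con B" for B
      using p(2) that by (simp add: BB_def)
    show "affind K p" if K: "card K = k + 1" "\<And>i j. i \<in> K \<Longrightarrow> j \<in> K \<Longrightarrow> i \<noteq> j \<Longrightarrow> {i, j} \<in> edges C" for K
    proof (rule p(3))
      have "i \<in> \<Union>C" if "i \<in> K" for i
      proof -
        have "card (K - {i}) = k" using K(1) that by simp
        then have "K - {i} \<noteq> {}" using k2 by (intro notI) simp
        then obtain j where "j \<in> K" "j \<noteq> i" by blast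
        then have "{i, j} \<in> edges C" using K(2) that by blast
        then show ?thesis by (auto simp: edge_iff)
      qed
      then show "K \<in> KK" using K by (auto simp: KK_def)
    qed
  qed
  moreover have "K \<in> KK" if "K \<in> C" for K
    using that less.prems(2) by (auto simp: KK_def edge_iff)
  ultimately show ?case using p(1,3) by blast
qed

end

section \<open>Circuits as multisets, and the main result\<close>

lemma vertices_eq: "vertices S = \<Union>(set_mset S)"
  by (auto simp: vertices_def faces_def)

lemma graph_of_eq: "graph_of S = (\<Union>(set_mset S), edges (set_mset S))"
proof -
  have "faces 1 S = edges (set_mset S)"
    unfolding faces_def edges_def by (auto intro: card_ge_0_finite)
  then show ?thesis by (simp add: graph_of_def vertices_eq)
qed

lemma simplicial_cycle_mset_set:
  assumes "finite D" "\<And>K. K \<in> D \<Longrightarrow> finite K \<and> card K = k + 1" "2 \<le> k"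
  shows "simplicial_cycle k (mset_set D) \<longleftrightarrow> cycle_along k id D"
proof -
  have sz: "size {#s \<in># mset_set D. F \<subseteq> s#} = card {K \<in> D. F \<subseteq> K}" for F
    using assms(1) by (simp add: filter_mset_mset_set)
  have "multicomplex k (mset_set D)" using assms by (simp add: multicomplex_def)
  moreover have "F \<in> boundary k (mset_set D) \<longleftrightarrow> card F = k \<and> odd (card {K \<in> D. F \<subseteq> K})" for F
  proof
    assume F: "card F = k \<and> odd (card {K \<in> D. F \<subseteq> K})"
    then have "{K \<in> D. F \<subseteq> K} \<noteq> {}" by (metis card.empty even_zero)
    then have "F \<subseteq> vertices (mset_set D)" using assms(1) by (auto simp: vertices_eq)
    moreover have "finite F" using F assms(3) by (metis card.infinite not_numeral_le_zero)
    ultimately show "F \<in> boundary k (mset_set D)" using F by (simp add: boundary_def sz)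
  qed (simp add: boundary_def sz)
  ultimately show ?thesis
    unfolding simplicial_cycle_def cycle_along_def by auto
qed

text \<open>
  A circuit is a repeated simplex or has no repeated faces.
\<close>

lemma simplicial_circuit_cases:
  assumes "simplicial_circuit k S" "2 \<le> k"
  obtains (double) K where "S = {#K, K#}"
    | (simple) "S = mset_set (set_mset S)" "circuit_along k id (set_mset S)"
proof (cases "\<exists>K. 2 \<le> count S K")
  case True
  then obtain K where K: "2 \<le> count S K" by blast
  have sub: "{#K, K#} \<subseteq># S" using K by (simp add: subseteq_mset_def)
  have "K \<in># S" using K by (simp flip: count_greater_zero_iff)
  then have "multicomplex k {#K, K#}"
    using assms(1) by (simp add: simplicial_circuit_def simplicial_cycle_def multicomplex_def)
  moreover have "boundary k {#K, K#} = {}" by (auto simp: boundary_def)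
  ultimately have "simplicial_cycle k {#K, K#}" by (simp add: simplicial_cycle_def)
  moreover have "\<forall>T. T \<subset># S \<and> T \<noteq> {#} \<longrightarrow> \<not> simplicial_cycle k T"
    using assms(1) by (simp add: simplicial_circuit_def)
  ultimately have "\<not> {#K, K#} \<subset># S" by (metis add_mset_not_empty)
  then have "S = {#K, K#}" using sub by (metis subset_mset.le_neq_trans)
  then show ?thesis by (rule double)
next
  case False
  define C where "C = set_mset S"
  have "S = mset_set C"
  proof (rule multiset_eqI)
    fix K
    have "count S K \<le> 1" using False by (metis not_less_eq_eq numeral_2_eq_2 One_nat_def)
    then show "count S K = count (mset_set C) K"
      unfolding C_def by (cases "K \<in># S") (simp_all add: le_antisym not_in_iff)
  qed
  note S = this
  have finC: "finite C" by (simp add: C_def)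
  have face: "finite K \<and> card K = k + 1" if "K \<in> C" for K
    using assms(1) that
    by (simp add: simplicial_circuit_def simplicial_cycle_def multicomplex_def C_def)
  have cyc: "simplicial_cycle k (mset_set D) \<longleftrightarrow> cycle_along k id D" if "D \<subseteq> C" for D
    using that finC face finite_subset by (intro simplicial_cycle_mset_set assms(2)) blast+
  have "circuit_along k id C"
    unfolding circuit_along_def
  proof (intro conjI allI impI)
    show "C \<noteq> {}" using assms(1) by (simp add: simplicial_circuit_def C_def)
    have "simplicial_cycle k (mset_set C)" using assms(1) S by (simp add: simplicial_circuit_def)
    then show "cycle_along k id C" using cyc[of C] by blast
    fix D assume D: "D \<subset> C \<and> D \<noteq> {}"
    then have finD: "finite D" using finC finite_subset by blast
    have "mset_set D \<subseteq># S"
      unfolding S using D finC by (intro subset_imp_msubset_mset_set) auto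
    moreover have "mset_set D \<noteq> S" using D finD finC S by (metis finite_set_mset_mset_set psubset_eq)
    moreover have "mset_set D \<noteq> {#}" using D finD by (simp add: mset_set_empty_iff)
    moreover have "\<forall>T. T \<subset># S \<and> T \<noteq> {#} \<longrightarrow> \<not> simplicial_cycle k T"
      using assms(1) by (simp add: simplicial_circuit_def)
    ultimately have "\<not> simplicial_cycle k (mset_set D)" by (metis subset_mset.le_neq_trans)
    then show "\<not> cycle_along k id D" using cyc[of D] D by blast
  qed
  then show ?thesis using simple S unfolding C_def by blast
qed

lemma nonidentity_involution:
  assumes "point_group_of_order_two (\<Gamma> :: (real^'n^'n) set)"
  shows "nonidentity \<Gamma> ** nonidentity \<Gamma> = mat 1" "nonidentity \<Gamma> \<noteq> mat 1"
proof -
  define g where "g = nonidentity \<Gamma>"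
  have sub: "subgroup \<Gamma> orthogonal_group" and c: "card \<Gamma> = 2"
    using assms by (auto simp: point_group_of_order_two_def)
  have g: "g \<in> \<Gamma>" "g \<noteq> mat 1"
    using theI'[OF ex1_nonidentity[OF assms]] unfolding g_def nonidentity_def by blast+
  have "\<Gamma> \<subseteq> {A. orthogonal_matrix A}"
    using subgroup.subset[OF sub] by (simp add: orthogonal_group_def)
  then have orth: "transpose g ** g = mat 1" using g(1) by (auto simp: orthogonal_matrix_def)
  have "g ** g \<in> \<Gamma>" using subgroup.m_closed[OF sub g(1) g(1)] by (simp add: orthogonal_group_def)
  have "g ** g = mat 1"
  proof (rule ccontr)
    assume "g ** g \<noteq> mat 1"
    then have "g ** g = g"
      using ex1_nonidentity[OF assms] g \<open>g ** g \<in> \<Gamma>\<close> by blast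
    then have "transpose g ** (g ** g) = transpose g ** g" by simp
    then have "g = mat 1" by (simp add: matrix_mul_assoc orth)
    with g(2) show False by contradiction
  qed
  then show "nonidentity \<Gamma> ** nonidentity \<Gamma> = mat 1" "nonidentity \<Gamma> \<noteq> mat 1"
    using g(2) unfolding g_def by blast+
qed

theorem theorem4p5:
  fixes k :: nat
    and S :: "'v set multiset"
    and G :: "'v graph"
    and X :: "'v set"
    and star :: "'v \<Rightarrow> 'v"
    and \<Gamma> :: "(real^'n^'n) set"
  assumes "k \<ge> 2"
    and "CARD('n) = k + 1"
    and "simplicial_circuit k S"
    and "G = graph_of S"
    and "nonadjacent_pairing G X star"
    and "point_group_of_order_two \<Gamma>"
    and "card X \<le> 2 * k"
  shows "Gamma_rigid \<Gamma> G X star"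
proof -
  define C where "C = set_mset S"
  have G: "G = (\<Union>C, edges C)" using assms(4) by (simp add: graph_of_eq C_def)
  have multi: "multicomplex k S"
    using assms(3) by (simp add: simplicial_circuit_def simplicial_cycle_def)
  then have face: "card K = k + 1" if "K \<in> C" for K
    using that by (simp add: multicomplex_def C_def)
  have "finite (fst G)"
    using finite_simple_graph_graph_of[OF multi] assms(4) by (simp add: finite_simple_graph_def)
  then have "finite X" using assms(5) finite_subset by (auto simp: nonadjacent_pairing_def)
  then interpret P: symmetric_pairing X star "nonidentity \<Gamma>" k
    using assms nonidentity_involution[OF assms(6)]
    by unfold_locales (auto simp: nonadjacent_pairing_def)
  have nonadj: "{x, star x} \<notin> edges C" if "x \<in> X" for x
    using assms(5) that by (simp add: nonadjacent_pairing_def G)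
  then have one: "P.one_adjacent_pair C" by (simp add: P.one_adjacent_pair_def)
  have "\<exists>p. P.symmetric p \<and> infinitesimally_rigid (\<Union>C, edges C) p"
    using assms(3,1)
  proof (cases rule: simplicial_circuit_cases)
    case (double K)
    then have C: "C = {K}" by (simp add: C_def)
    have "P.few_pairs K"
      by (rule P.few_pairs_clique[OF one]) (simp add: edge_iff C)
    moreover have "card K = k + 1" using face C by simp
    ultimately show ?thesis using P.simplex_rigid[of K] unfolding C by blast
  next
    case simple
    have "finite C" by (simp add: C_def)
    from P.circuit_rigid[OF this face _ one] simple(2) show ?thesis unfolding C_def by blast
  qed
  then show ?thesis
    unfolding Gamma_rigid_def P.symmetric_def G by blast
qed

end
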